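(* Let $\tau:S^1\to S^1$ be the free involution $\tau(x)=x+\frac12$, where $S^1=\mathbb{T}^1=\mathbb{R}/\mathbb{Z}$. Let $f:S^1\to S^1$ be a continuous map whose induced homomorphism $f_{\#}$ on the fundamental group $\pi_1(S^1)=\mathbb{Z}$ is multiplication by $a\in\mathbb{Z}$. Then $$\mathrm{NBU}(f,\tau)=\begin{cases}1 & \text{if } a \text{ is even},\\ 0 & \text{if } a\text{ is odd}.\end{cases}$$ Moreover, for each continuous map $f:S^1\to S^1$ there exists a map $f'$ homotopic to $f$ that realizes $\mathrm{NBU}(f,\tau)$, i.e. $S^1$ is a Wecken type space in Nielsen-Borsuk-Ulam theory.
   Context: $\mathbb{T}^n=\mathbb{R}^n/\mathbb{Z}^n$ is the $n$-torus, written additively, and $\pi_1(\mathbb{T}^n)=\mathbb{Z}^n$. Maps are continuous. **Borsuk-Ulam coincidence classes.** Let $X,Y$ be closed orientable triangulable $n$-manifolds, $\tau$ a free involution on $X$, and $f:X\to Y$ a map with $\mathrm{Coin}(f,f\circ\tau)=\{x\in X: f(x)=f(\tau(x))\}$ finite, say equal to $\{x_1,\tau(x_1),\dots,x_m,\tau(x_m)\}$. Put $\mathrm{BUCoin}(f,\tau)=\{(x_1,\tau(x_1)),\dots,(x_m,\tau(x_m))\}$ (one pair for each $\tau$-orbit). Two pairs $(x_i,\tau(x_i))$, $(x_j,\tau(x_j))$ are in the same Borsuk-Ulam coincidence class if there is a path $\gamma$ from a point of $\{x_i,\tau(x_i)\}$ to a point of $\{x_j,\tau(x_j)\}$ such that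 $f\circ\gamma$ is homotopic to $f\circ\tau\circ\gamma$ with fixed endpoints. A class $C$ is single if for one (equivalently any) pair $(x,\tau(x))\in C$ there is a path $\gamma$ from $x$ to $\tau(x)$ with $f\circ\gamma$ homotopic to $f\circ\tau\circ\gamma$ rel endpoints; otherwise it is double. A single class consists of exactly one usual (Nielsen) coincidence class of $(f,f\circ\tau)$; a double class $C=\{(x_1,\tau(x_1)),\dots,(x_k,\tau(x_k))\}$ can be relabelled so that $C=C_1\cup C_2$ with $C_1=\{x_1,\dots,x_k\}$ and $C_2=\{\tau(x_1),\dots,\tau(x_k)\}$ two distinct usual coincidence classes of $(f,f\circ\tau)$. **Pseudo-index.** Let $\mathrm{ind}(f,f\circ\tau;c)$ be the usual local coincidence index at an isolated coincidence $c$ (for $X=Y=\mathbb{T}^n$ it is, up to a global sign convention, the local degree at $c$ of $x\mapsto f(x)-f(\tau(x))$ as a map near $c$ into a neighbourhood of $0\in\mathbb{T}^n$), and let the index of a finite set of coincidences be the sum of the local indices. Call the situation of type A if ($\tau$ reverses orientation and $n$ is even) or ($\tau$ preserves orientation and $n$ is odd), and of type B if ($\tau$ preserves orientation and $n$ is even) or ($\tau$ reverses orientation and $n$ is odd). The pseudo-index $|\mathrm{ind}|(f,\tau;C)$ of a class $C=\{(x_1,\tau(x_1)),\dots,(x_k,\tau(x_k))\}$ is: $\sum_{i=1}^k \mathrm{ind}(f,f\circ\tau;x_i) \bmod 2$ if $C$ is single and type A; $\frac12\mathrm{ind}(f,f\circ\tau;C)$ if $C$ is single and type B; $|\mathrm{ind}(f,f\circ\tau;C_1)|$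 if $C=C_1\cup C_2$ is double and type A; $\mathrm{ind}(f,f\circ\tau;C_1)$ if $C=C_1\cup C_2$ is double and type B. **Nielsen-Borsuk-Ulam number.** A class $C$ is essential if $|\mathrm{ind}|(f,\tau;C)\neq0$. $\mathrm{NBU}(f,\tau)$ is the number of essential Borsuk-Ulam coincidence classes. It is a homotopy invariant of $f$; for an arbitrary map $f$ it is computed on any map homotopic to $f$ with finite coincidence set. Every map homotopic to $f$ has at least $\mathrm{NBU}(f,\tau)$ pairs of Borsuk-Ulam coincidence points. A map $f'$ homotopic to $f$ realizes $\mathrm{NBU}(f,\tau)$ if $\mathrm{BUCoin}(f',\tau)$ has exactly $\mathrm{NBU}(f,\tau)$ pairs; being a Wecken type space means that such an $f'$ exists for each selfmap $f$. *)

theory Defs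
  imports "HOL-Analysis.Analysis" "HOL-Homology.Homology"
begin

section \<open>The circle as the topological group \<open>\<real>/\<int>\<close>\<close>

quotient_type circle = real / "\<lambda>x y. x - y \<in> \<int>"
  morphisms real_of_circle circle_of_real
proof (rule equivpI)
  show "reflp (\<lambda>x y::real. x - y \<in> \<int>)"
    by (simp add: reflp_def)
  show "symp (\<lambda>x y::real. x - y \<in> \<int>)"
  proof (rule sympI)
    fix x y :: real
    assume "x - y \<in> \<int>"
    then have "- (x - y) \<in> \<int>" by (rule Ints_minus)
    then show "y - x \<in> \<int>" by simp
  qed
  show "transp (\<lambda>x y::real. x - y \<in> \<int>)"
  proof (rule transpI)
    fix x y z :: real
    assume "x - y \<in> \<int>" "y - z \<in> \<int>"
    then have "(x - y) + (y - z) \<in> \<int>" by (rule Ints_add)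
    then show "x - z \<in> \<int>" by simp
  qed
qed

instantiation circle :: ab_group_add
begin

lift_definition zero_circle :: circle is 0 .

lift_definition plus_circle :: "circle \<Rightarrow> circle \<Rightarrow> circle" is "(+)"
proof -
  fix x y u v :: real
  assume "x - y \<in> \<int>" "u - v \<in> \<int>"
  then have "(x - y) + (u - v) \<in> \<int>" by (rule Ints_add)
  then show "(x + u) - (y + v) \<in> \<int>" by (simp add: algebra_simps)
qed

lift_definition uminus_circle :: "circle \<Rightarrow> circle" is uminus
proof -
  fix x y :: real
  assume "x - y \<in> \<int>"
  then have "- (x - y) \<in> \<int>" by (rule Ints_minus)
  then show "- x - - y \<in> \<int>" by simp
qed

lift_definition minus_circle :: "circle \<Rightarrow> circle \<Rightarrow> circle" is "(-)"
proof -
  fix x y u v :: real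
  assume "x - y \<in> \<int>" "u - v \<in> \<int>"
  then have "(x - y) - (u - v) \<in> \<int>" by (rule Ints_diff)
  then show "(x - u) - (y - v) \<in> \<int>" by (simp add: algebra_simps)
qed

instance
  by standard (transfer; simp add: algebra_simps)+

end

instantiation circle :: topological_space
begin

text \<open>The quotient topology.\<close>

definition open_circle :: "circle set \<Rightarrow> bool"
  where "open_circle U \<longleftrightarrow> open (circle_of_real -` U)"

instance
  by standard (auto simp: open_circle_def vimage_Int vimage_Union)

end

text \<open>The inverse of the chart at \<open>0\<close>: the representative in \<open>(-1/2, 1/2]\<close>.\<close>

definition circle_log :: "circle \<Rightarrow> real"
  where "circle_log y = (THE t. - 1 / 2 < t \<and> t \<le> 1 / 2 \<and> circle_of_real t = y)"

definition circle_loop :: "circle \<Rightarrow> int \<Rightarrow> real \<Rightarrow> circle"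
  where "circle_loop x k = (\<lambda>t. x + circle_of_real (of_int k * t))"

text \<open>The fundamental group of the circle at \<open>x\<close> is identified with \<open>\<int>\<close> by letting
  \<open>k\<close> correspond to the homotopy class of \<open>circle_loop x k\<close>. Under this identification
  the homomorphism induced by \<open>f\<close>, sending the class of a loop \<open>\<gamma>\<close> to the class of \<open>f \<circ> \<gamma>\<close>,
  is multiplication by \<open>a\<close>.\<close>

definition pi1_multiplication :: "(circle \<Rightarrow> circle) \<Rightarrow> int \<Rightarrow> bool"
  where "pi1_multiplication f a \<longleftrightarrow>
    (\<forall>x k \<gamma>. homotopic_paths UNIV \<gamma> (circle_loop x k) \<longrightarrow>
       homotopic_paths UNIV (f \<circ> \<gamma>) (circle_loop (f x) (a * k)))"

section \<open>Borsuk-Ulam coincidence classes\<close>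

definition Coin :: "('a \<Rightarrow> 'b) \<Rightarrow> ('a \<Rightarrow> 'b) \<Rightarrow> 'a set"
  where "Coin f g = {x. f x = g x}"

definition Nielsen_rel ::
    "('a::topological_space \<Rightarrow> 'b::topological_space) \<Rightarrow> ('a \<Rightarrow> 'b) \<Rightarrow> 'a \<Rightarrow> 'a \<Rightarrow> bool"
  where "Nielsen_rel f g x y \<longleftrightarrow>
    (\<exists>\<gamma>. path \<gamma> \<and> pathstart \<gamma> = x \<and> pathfinish \<gamma> = y \<and> homotopic_paths UNIV (f \<circ> \<gamma>) (g \<circ> \<gamma>))"

definition Nielsen_classes ::
    "('a::topological_space \<Rightarrow> 'b::topological_space) \<Rightarrow> ('a \<Rightarrow> 'b) \<Rightarrow> 'a set set"
  where "Nielsen_classes f g =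
    Coin f g // {(x, y). x \<in> Coin f g \<and> y \<in> Coin f g \<and> Nielsen_rel f g x y}"

text \<open>A pair \<open>(x, \<tau> x)\<close>, taken once for each \<open>\<tau>\<close>-orbit, is represented by the orbit
  \<open>{x, \<tau> x}\<close> itself.\<close>

definition BUCoin :: "('a \<Rightarrow> 'b) \<Rightarrow> ('a \<Rightarrow> 'a) \<Rightarrow> 'a set set"
  where "BUCoin f \<tau> = (\<lambda>x. {x, \<tau> x}) ` Coin f (f \<circ> \<tau>)"

definition BU_classes ::
    "('a::topological_space \<Rightarrow> 'b::topological_space) \<Rightarrow> ('a \<Rightarrow> 'a) \<Rightarrow> 'a set set set"
  where "BU_classes f \<tau> =
    BUCoin f \<tau> // {(P, Q). P \<in> BUCoin f \<tau> \<and> Q \<in> BUCoin f \<tau> \<and>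
                       (\<exists>x\<in>P. \<exists>y\<in>Q. Nielsen_rel f (f \<circ> \<tau>) x y)}"

definition single_class ::
    "('a::topological_space \<Rightarrow> 'b::topological_space) \<Rightarrow> ('a \<Rightarrow> 'a) \<Rightarrow> 'a set set \<Rightarrow> bool"
  where "single_class f \<tau> C \<longleftrightarrow> (\<exists>P\<in>C. \<exists>x\<in>P. Nielsen_rel f (f \<circ> \<tau>) x (\<tau> x))"

section \<open>Index and pseudo-index on the circle\<close>

text \<open>The local degree of \<open>\<phi>\<close> at an isolated point \<open>c\<close> of the fibre over \<open>\<phi> c\<close>: in the charts
  \<open>t \<mapsto> c + [t]\<close> and \<open>t \<mapsto> \<phi> c + [t]\<close>, the degree of the map \<open>S\<^sup>0 \<rightarrow> S\<^sup>0\<close> obtained by normalising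
  the values of \<open>\<phi>\<close> on a sufficiently small sphere of radius \<open>\<epsilon>\<close> about \<open>c\<close>. Points of
  \<open>nsphere 0\<close> are sequences \<open>x\<close> with \<open>x 0 = 1\<close> or \<open>x 0 = -1\<close> and all other entries zero.\<close>

definition local_degree :: "(circle \<Rightarrow> circle) \<Rightarrow> circle \<Rightarrow> int"
  where "local_degree \<phi> c =
    (THE d. \<forall>\<^sub>F \<epsilon> in at_right (0::real).
       Brouwer_degree2 0
         (\<lambda>x i. if i = 0 then sgn (circle_log (\<phi> (c + circle_of_real (\<epsilon> * x 0)) - \<phi> c)) else 0) = d)"

definition coin_index :: "(circle \<Rightarrow> circle) \<Rightarrow> (circle \<Rightarrow> circle) \<Rightarrow> circle \<Rightarrow> int"
  where "coin_index f g c = local_degree (\<lambda>x. f x - g x) c"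

definition orientation_preserving :: "(circle \<Rightarrow> circle) \<Rightarrow> bool"
  where "orientation_preserving \<tau> \<longleftrightarrow> (\<forall>c. local_degree \<tau> c = 1)"

definition orientation_reversing :: "(circle \<Rightarrow> circle) \<Rightarrow> bool"
  where "orientation_reversing \<tau> \<longleftrightarrow> (\<forall>c. local_degree \<tau> c = - 1)"

text \<open>The parameter \<open>n\<close> is the dimension of the manifold. A homeomorphism of the circle either
  preserves or reverses orientation, so type B is the negation of type A.\<close>

definition type_A :: "nat \<Rightarrow> (circle \<Rightarrow> circle) \<Rightarrow> bool"
  where "type_A n \<tau> \<longleftrightarrow>
    orientation_reversing \<tau> \<and> even n \<or> orientation_preserving \<tau> \<and> odd n"

text \<open>In the first case the sum uses one representative of each orbit, in the last two cases one
  of the two Nielsen classes forming a double class; for a free involution \<open>\<tau>\<close> the value does not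
  depend on these choices. In the second case the sum is even.\<close>

definition pseudo_index :: "(circle \<Rightarrow> circle) \<Rightarrow> (circle \<Rightarrow> circle) \<Rightarrow> circle set set \<Rightarrow> int"
  where "pseudo_index f \<tau> C =
    (let ind = coin_index f (f \<circ> \<tau>);
         C\<^sub>1 = (SOME D. D \<in> Nielsen_classes f (f \<circ> \<tau>) \<and> D \<subseteq> \<Union> C)
     in if single_class f \<tau> C
        then if type_A 1 \<tau> then (\<Sum>P\<in>C. ind (SOME x. x \<in> P)) mod 2
             else (\<Sum>x\<in>\<Union> C. ind x) div 2
        else if type_A 1 \<tau> then \<bar>\<Sum>x\<in>C\<^sub>1. ind x\<bar>
             else (\<Sum>x\<in>C\<^sub>1. ind x))"

section \<open>The Nielsen-Borsuk-Ulam number\<close>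

definition NBU_finite :: "(circle \<Rightarrow> circle) \<Rightarrow> (circle \<Rightarrow> circle) \<Rightarrow> nat"
  where "NBU_finite f \<tau> = card {C \<in> BU_classes f \<tau>. pseudo_index f \<tau> C \<noteq> 0}"

definition NBU :: "(circle \<Rightarrow> circle) \<Rightarrow> (circle \<Rightarrow> circle) \<Rightarrow> nat"
  where "NBU f \<tau> =
    (THE m. \<exists>g. homotopic_with_canon (\<lambda>_. True) UNIV UNIV f g \<and>
                finite (Coin g (g \<circ> \<tau>)) \<and> NBU_finite g \<tau> = m)"

definition realizes_NBU ::
    "(circle \<Rightarrow> circle) \<Rightarrow> (circle \<Rightarrow> circle) \<Rightarrow> (circle \<Rightarrow> circle) \<Rightarrow> bool"
  where "realizes_NBU f' f \<tau> \<longleftrightarrow>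
    homotopic_with_canon (\<lambda>_. True) UNIV UNIV f f' \<and>
    finite (BUCoin f' \<tau>) \<and> card (BUCoin f' \<tau>) = NBU f \<tau>"

definition half_turn :: "circle \<Rightarrow> circle"
  where "half_turn x = x + circle_of_real (1 / 2)"

lemma half_turn_involution: "half_turn (half_turn x) = x"
  unfolding half_turn_def by transfer simp

lemma half_turn_free: "half_turn x \<noteq> x"
proof -
  have "(1 / 2 :: real) \<notin> \<int>"
  proof
    assume "(1 / 2 :: real) \<in> \<int>"
    then obtain k :: int where "1 / 2 = (of_int k :: real)" by (rule Ints_cases)
    then have "real_of_int (2 * k) = real_of_int 1" by simp
    then have "2 * k = 1" by (simp only: of_int_eq_iff)
    then show False by presburger
  qed
  then show ?thesis
    unfolding half_turn_def by transfer simp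
qed

end

theory Submission
  imports Defs
begin

text \<open>
  Lift \<open>f\<close> to \<open>F : \<real> \<rightarrow> \<real>\<close> with \<open>F (t + 1) = F t + a\<close> and put \<open>G t = F (t + 1/2) - F t\<close>. Then \<open>G\<close> has
  period \<open>1\<close> and \<open>G t + G (t + 1/2) = a\<close>. The coincidences of \<open>f\<close> and \<open>f \<circ> \<tau>\<close> are the points where
  \<open>G\<close> is an integer, and two of them are Nielsen equivalent iff \<open>G\<close> has the same value \<open>m\<close> there. The
  index counts the signed crossings of the level \<open>m\<close>, so over a whole period it is \<open>0\<close>: all double
  classes are inessential. A class is single iff \<open>m = a/2\<close>, which needs \<open>a\<close> even, and then \<open>G - a/2\<close>
  changes sign under \<open>t \<mapsto> t + 1/2\<close>, so the number of crossings in half a period is odd.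
  The minimum is realized by \<open>a t\<close> for odd \<open>a\<close> and by \<open>a t + cos (2 \<pi> t) / 4\<close> for even \<open>a\<close>.
\<close>

section \<open>The topology of the circle\<close>

lemma circle_of_real_eq_iff: "circle_of_real x = circle_of_real y \<longleftrightarrow> x - y \<in> \<int>"
  by (rule circle.abs_eq_iff)

lemma circle_of_real_add: "circle_of_real (x + y) = circle_of_real x + circle_of_real y"
  by (simp add: plus_circle.abs_eq)

lemma circle_of_real_diff: "circle_of_real (x - y) = circle_of_real x - circle_of_real y"
  by (simp add: minus_circle.abs_eq)

lemma circle_of_real_cases: obtains t where "x = circle_of_real t"
  by (metis Quotient_abs_rep Quotient_circle)

lemma circle_of_real_add_half: "circle_of_real (t + 1/2) = half_turn (circle_of_real t)"
  by (simp add: half_turn_def circle_of_real_add)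

lemma continuous_on_circle_of_real: "continuous_on A circle_of_real"
  by (rule continuous_on_subset [of UNIV])
     (auto simp: continuous_on_open_vimage open_circle_def)

text \<open>This is the universal property of the quotient topology: a set of circle points is open
  exactly when its preimage in the line is.\<close>

lemma continuous_on_circleI:
  assumes "continuous_on UNIV (\<lambda>t. h (circle_of_real t))"
  shows "continuous_on UNIV h"
proof -
  have "open (h -` B)" if "open B" for B
  proof -
    have "open ((\<lambda>t. h (circle_of_real t)) -` B)"
      using assms that by (simp add: continuous_on_open_vimage)
    then show ?thesis by (simp add: open_circle_def vimage_def)
  qed
  then show ?thesis by (simp add: continuous_on_open_vimage)
qed

text \<open>Used to let functions built on the line descend to the circle: the displacement between
  two lifts, and the map with few coincidences.\<close>

lemma circle_function_of_periodic:
  fixes D :: "real \<Rightarrow> 'a::topological_space"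
  assumes "continuous_on UNIV D" and per: "\<And>s t. s - t \<in> \<int> \<Longrightarrow> D s = D t"
  obtains h where "continuous_on UNIV h" "\<And>t. h (circle_of_real t) = D t"
proof
  let ?h = "\<lambda>x. D (SOME t. circle_of_real t = x)"
  show eq: "?h (circle_of_real t) = D t" for t
    by (rule per) (metis (mono_tags) circle_of_real_eq_iff someI_ex)
  show "continuous_on UNIV ?h"
    using assms(1) by (intro continuous_on_circleI) (simp add: eq)
qed

section \<open>The embedding of the circle in the complex plane\<close>

lift_definition circle_exp :: "circle \<Rightarrow> complex" is "\<lambda>t. exp (2 * pi * \<i> * of_real t)"
proof -
  fix x y :: real
  assume "x - y \<in> \<int>"
  then obtain n where "x - y = of_int n" by (rule Ints_cases)
  then have "x = y + of_int n" by simp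
  then have "2 * pi * \<i> * of_real x = 2 * pi * \<i> * of_real y + (of_int (2 * n) * pi) * \<i>"
    by (simp add: complex_eq_iff distrib_left)
  then show "exp (2 * pi * \<i> * of_real x) = exp (2 * pi * \<i> * of_real y)"
    unfolding exp_eq by blast
qed

lemma circle_exp_of_real: "circle_exp (circle_of_real t) = exp (2 * pi * \<i> * of_real t)"
  by (simp add: circle_exp.abs_eq)

lemma circle_exp_add: "circle_exp (x + y) = circle_exp x * circle_exp y"
  by transfer (simp add: distrib_left exp_add)

lemma circle_exp_nonzero: "circle_exp x \<noteq> 0"
  by transfer simp

lemma inj_circle_exp: "inj circle_exp"
proof (rule injI)
  fix x y
  assume *: "circle_exp x = circle_exp y"
  obtain s t where st: "x = circle_of_real s" "y = circle_of_real t"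
    by (metis circle_of_real_cases)
  from * obtain n where "2 * pi * \<i> * of_real s = 2 * pi * \<i> * of_real t + (of_int (2 * n) * pi) * \<i>"
    unfolding st circle_exp_of_real exp_eq by blast
  then have "2 * pi * s = 2 * pi * t + 2 * pi * of_int n"
    by (simp add: complex_eq_iff)
  then have "2 * pi * s = 2 * pi * (t + of_int n)"
    by (simp only: distrib_left)
  then have "s = t + of_int n" by simp
  then show "x = y" by (simp add: st circle_of_real_eq_iff)
qed

lemma continuous_on_circle_exp: "continuous_on UNIV circle_exp"
  by (rule continuous_on_circleI) (unfold circle_exp_of_real, intro continuous_intros)

lemma compact_UNIV_circle: "compact (UNIV :: circle set)"
proof -
  have "x \<in> circle_of_real ` {0..1}" for x
  proof -
    obtain t where t: "x = circle_of_real t" by (rule circle_of_real_cases)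
    have "x = circle_of_real (frac t)"
      by (simp add: t circle_of_real_eq_iff frac_def)
    moreover have "frac t \<in> {0..1}" by (simp add: frac_ge_0 frac_lt_1 less_imp_le)
    ultimately show ?thesis by blast
  qed
  then have "UNIV = circle_of_real ` {0..1}" by blast
  then show ?thesis
    by (metis compact_Icc compact_continuous_image continuous_on_circle_of_real)
qed

text \<open>A continuous injection of a compact space into a Hausdorff space has a continuous
  inverse on its image, so continuity into the circle may be tested after applying
  \<open>circle_exp\<close>.\<close>

lemma continuous_on_into_circleI:
  assumes "continuous_on S (\<lambda>x. circle_exp (h x))"
  shows "continuous_on S h"
proof -
  have "continuous_on (range circle_exp) (inv_into UNIV circle_exp)"
    by (rule continuous_on_inv)
       (auto simp: continuous_on_circle_exp compact_UNIV_circle inj_circle_exp)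
  then have "continuous_on S (\<lambda>x. inv_into UNIV circle_exp (circle_exp (h x)))"
    by (rule continuous_on_compose2) (use assms in auto)
  then show ?thesis by (simp add: inj_circle_exp)
qed

lemma continuous_on_circle_add:
  fixes g h :: "'a::topological_space \<Rightarrow> circle"
  assumes "continuous_on S g" "continuous_on S h"
  shows "continuous_on S (\<lambda>x. g x + h x)"
proof (rule continuous_on_into_circleI)
  have "continuous_on S (\<lambda>x. circle_exp (k x))" if "continuous_on S k" for k
    by (rule continuous_on_compose2 [OF continuous_on_circle_exp that]) auto
  then show "continuous_on S (\<lambda>x. circle_exp (g x + h x))"
    by (simp add: circle_exp_add continuous_on_mult assms)
qed

text \<open>The nonvanishing function \<open>circle_exp\<close> of \<open>h\<close> has a continuous
  logarithm on a contractible set. Its values have modulus 1, so the logarithm is purely imaginary,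
  and dividing its imaginary part by 2 pi gives the lift.\<close>

lemma circle_lift:
  fixes h :: "'a::real_normed_vector \<Rightarrow> circle"
  assumes "continuous_on S h" "contractible S"
  obtains H where "continuous_on S H" "\<And>x. x \<in> S \<Longrightarrow> h x = circle_of_real (H x)"
proof -
  have "continuous_on S (\<lambda>x. circle_exp (h x))"
    by (rule continuous_on_compose2 [OF continuous_on_circle_exp assms(1)]) auto
  then obtain g where g: "continuous_on S g" "\<And>x. x \<in> S \<Longrightarrow> circle_exp (h x) = exp (g x)"
    using assms(2) circle_exp_nonzero by (rule continuous_logarithm_on_contractible) auto
  show thesis
  proof
    show "continuous_on S (\<lambda>x. Im (g x) / (2 * pi))"
      by (intro continuous_intros g) auto
    fix x assume x: "x \<in> S"
    obtain t where t: "h x = circle_of_real t" by (rule circle_of_real_cases)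
    have "norm (exp (g x)) = 1"
      by (simp flip: g(2) [OF x] add: t circle_exp_of_real)
    then have "Re (g x) = 0" by simp
    then have "2 * pi * \<i> * of_real (Im (g x) / (2 * pi)) = g x"
      by (simp add: complex_eq_iff)
    then have "circle_exp (circle_of_real (Im (g x) / (2 * pi))) = circle_exp (h x)"
      by (simp only: circle_exp_of_real g(2) [OF x])
    then show "h x = circle_of_real (Im (g x) / (2 * pi))"
      by (metis injD inj_circle_exp)
  qed
qed

section \<open>Lifts and degree\<close>

text \<open>The integer \<open>a\<close> is the degree of \<open>f\<close>, read off from a lift to
  the universal cover; \<open>pi1_multiplication_degree_lift\<close> identifies it with the action
  on the fundamental group.\<close>

definition degree_lift :: "(circle \<Rightarrow> circle) \<Rightarrow> (real \<Rightarrow> real) \<Rightarrow> int \<Rightarrow> bool"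
  where "degree_lift f F a \<longleftrightarrow> continuous_on UNIV F \<and>
    (\<forall>t. f (circle_of_real t) = circle_of_real (F t)) \<and> (\<forall>t. F (t + 1) = F t + of_int a)"

text \<open>Distinct integers are at distance at least 1. Since two lifts of one map differ by
  integers, this is what makes lifts unique up to a constant.\<close>

lemma continuous_on_integer_valued_constant:
  fixes h :: "'a::real_normed_vector \<Rightarrow> real"
  assumes "convex S" "continuous_on S h" "\<And>x. x \<in> S \<Longrightarrow> h x \<in> \<int>"
  shows "h constant_on S"
proof (rule continuous_discrete_range_constant)
  show "connected S" using assms(1) by (rule convex_connected)
  show "continuous_on S h" by fact
  fix x assume x: "x \<in> S"
  have "1 \<le> norm (h y - h x)" if y: "y \<in> S" "h y \<noteq> h x" for y
  proof -
    obtain m n where "h y = of_int m" "h x = of_int n"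
      using assms(3) x y(1) by (metis Ints_cases)
    with y(2) show ?thesis by (simp flip: of_int_diff of_int_abs)
  qed
  then show "\<exists>e>0. \<forall>y. y \<in> S \<and> h y \<noteq> h x \<longrightarrow> e \<le> norm (h y - h x)"
    by (intro exI [of _ 1]) auto
qed

lemma periodic_translate_of_int:
  fixes F :: "real \<Rightarrow> real"
  assumes "\<And>t. F (t + 1) = F t + c"
  shows "F (t + of_int n) = F t + c * of_int n"
proof -
  have nat: "F (s + of_nat k) = F s + c * of_nat k" for s k
  proof (induction k)
    case (Suc k)
    then show ?case
      using assms [of "s + of_nat k"] by (simp add: algebra_simps)
  qed simp
  show ?thesis
  proof (cases "n \<ge> 0")
    case True
    then show ?thesis using nat [of t "nat n"] by simp
  next
    case False
    then show ?thesis using nat [of "t + of_int n" "nat (-n)"] by simp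
  qed
qed

lemma degree_lift_translate:
  assumes "degree_lift f F a"
  shows "F (t + of_int n) = F t + of_int a * of_int n"
  using assms by (intro periodic_translate_of_int) (simp add: degree_lift_def)

text \<open>The integer \<open>K (s, t + 1) - K (s, t)\<close> varies continuously, so lifting a whole homotopy \<open>h\<close>
  shows that its two ends have the same degree.\<close>

lemma degree_lift_homotopy:
  fixes h :: "real \<times> circle \<Rightarrow> circle"
  assumes "continuous_on ({0..1} \<times> UNIV) h"
  obtains a F G where "degree_lift (\<lambda>x. h (0, x)) F a" "degree_lift (\<lambda>x. h (1, x)) G a"
proof -
  let ?S = "{0..1::real} \<times> (UNIV :: real set)"
  have conv: "convex ?S" by (intro convex_Times) auto
  have "continuous_on ?S (\<lambda>z. (fst z, circle_of_real (snd z)))"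
    by (intro continuous_on_Pair continuous_on_fst continuous_on_id
        continuous_on_compose2 [OF continuous_on_circle_of_real continuous_on_snd]) auto
  then have "continuous_on ?S (\<lambda>z. h (fst z, circle_of_real (snd z)))"
    by (rule continuous_on_compose2 [OF assms]) auto
  then obtain K where K: "continuous_on ?S K"
      "\<And>z. z \<in> ?S \<Longrightarrow> h (fst z, circle_of_real (snd z)) = circle_of_real (K z)"
    using convex_imp_contractible [OF conv] by (rule circle_lift) auto
  let ?D = "\<lambda>z. K (fst z, snd z + 1) - K z"
  have "continuous_on ?S (\<lambda>z. K (fst z, snd z + 1))"
    by (rule continuous_on_compose2 [OF K(1)]) (auto intro!: continuous_intros)
  then have "continuous_on ?S ?D"
    by (intro continuous_intros K)
  moreover have int: "?D z \<in> \<int>" if "z \<in> ?S" for z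
  proof -
    have "circle_of_real (K (fst z, snd z + 1)) = circle_of_real (K z)"
    proof -
      have "circle_of_real (snd z + 1) = circle_of_real (snd z)"
        by (simp add: circle_of_real_eq_iff)
      then show ?thesis
        using K(2) [of z] K(2) [of "(fst z, snd z + 1)"] that by auto
    qed
    then show ?thesis by (simp add: circle_of_real_eq_iff)
  qed
  ultimately have "?D constant_on ?S"
    by (intro continuous_on_integer_valued_constant [OF conv]) auto
  then obtain c where c: "\<And>z. z \<in> ?S \<Longrightarrow> ?D z = c"
    by (auto simp: constant_on_def)
  have "c \<in> \<int>" using int [of "(0, 0)"] c [of "(0, 0)"] by auto
  then obtain a where a: "c = of_int a" by (rule Ints_cases)
  have "degree_lift (\<lambda>x. h (s, x)) (\<lambda>t. K (s, t)) a" if s: "s \<in> {0..1}" for s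
    unfolding degree_lift_def
  proof (intro conjI allI)
    show "continuous_on UNIV (\<lambda>t. K (s, t))"
      by (rule continuous_on_compose2 [OF K(1)]) (use s in \<open>auto intro!: continuous_intros\<close>)
    fix t
    show "h (s, circle_of_real t) = circle_of_real (K (s, t))"
      using K(2) [of "(s, t)"] s by auto
    show "K (s, t + 1) = K (s, t) + of_int a"
      using c [of "(s, t)"] s by (auto simp: a)
  qed
  from this [of 0] this [of 1] show thesis by (intro that) auto
qed

text \<open>Apply \<open>degree_lift_homotopy\<close> to the constant homotopy.\<close>

lemma degree_lift_exists:
  assumes "continuous_on UNIV f"
  obtains F a where "degree_lift f F a"
proof -
  have "continuous_on ({0..1} \<times> UNIV) (\<lambda>z::real \<times> circle. f (snd z))"
    by (rule continuous_on_compose2 [OF assms]) (auto intro!: continuous_intros)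
  from degree_lift_homotopy [OF this] that show thesis by auto
qed

lemma degree_lift_imp_continuous:
  assumes "degree_lift f F a"
  shows "continuous_on UNIV f"
proof (rule continuous_on_circleI)
  have "continuous_on UNIV (\<lambda>t. circle_of_real (F t))"
    by (rule continuous_on_compose2 [OF continuous_on_circle_of_real [of UNIV]])
       (use assms in \<open>auto simp: degree_lift_def\<close>)
  then show "continuous_on UNIV (\<lambda>t. f (circle_of_real t))"
    using assms by (simp add: degree_lift_def)
qed

text \<open>The difference of two lifts is a constant integer, so both grow by the same amount from
  0 to 1.\<close>

lemma degree_lift_unique:
  assumes "degree_lift f F a" "degree_lift f G b"
  shows "a = b"
proof -
  have "(\<lambda>t. F t - G t) constant_on UNIV"
  proof (rule continuous_on_integer_valued_constant)
    show "continuous_on UNIV (\<lambda>t. F t - G t)"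
      using assms by (auto simp: degree_lift_def intro!: continuous_intros)
    fix t
    have "circle_of_real (F t) = circle_of_real (G t)"
      using assms by (simp add: degree_lift_def)
    then show "F t - G t \<in> \<int>" by (simp add: circle_of_real_eq_iff)
  qed auto
  then have "F (0 + 1) - G (0 + 1) = F 0 - G 0"
    unfolding constant_on_def by (metis UNIV_I)
  moreover have "F (0 + 1) = F 0 + of_int a" "G (0 + 1) = G 0 + of_int b"
    using assms unfolding degree_lift_def by blast+
  ultimately show ?thesis by simp
qed

lemma homotopic_degree_lift:
  assumes "homotopic_with_canon (\<lambda>_. True) UNIV UNIV f g" "degree_lift f F a"
  obtains G where "degree_lift g G a"
proof -
  obtain h where h: "continuous_on ({0..1::real} \<times> UNIV) h" "\<And>x. h (0, x) = f x" "\<And>x. h (1, x) = g x"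
    using assms(1) unfolding homotopic_with_def prod_topology_subtopology_eu
    by auto
  from degree_lift_homotopy [OF h(1)] obtain b F' G where
    "degree_lift f F' b" "degree_lift g G b" unfolding h by blast
  moreover from this assms(2) have "a = b" by (blast intro: degree_lift_unique)
  ultimately show thesis using that by blast
qed

text \<open>Both lifts gain the same \<open>a\<close> over a period, so \<open>G - F\<close> has
  period 1 and descends to a real function \<open>D\<close> on the circle. Adding the class of
  \<open>s * D\<close> to \<open>f\<close> moves \<open>f\<close> to \<open>g\<close> as
  \<open>s\<close> runs from 0 to 1.\<close>

lemma degree_lift_homotopic:
  assumes F: "degree_lift f F a" and G: "degree_lift g G a"
  shows "homotopic_with_canon (\<lambda>_. True) UNIV UNIV f g"
proof -
  have "continuous_on UNIV (\<lambda>t. G t - F t)"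
    using assms by (auto simp: degree_lift_def intro!: continuous_intros)
  moreover have "G s - F s = G t - F t" if "s - t \<in> \<int>" for s t
  proof -
    from that obtain n where "s - t = of_int n" by (rule Ints_cases)
    then have "s = t + of_int n" by simp
    then show ?thesis
      by (simp add: degree_lift_translate [OF F] degree_lift_translate [OF G])
  qed
  ultimately obtain D where D: "continuous_on UNIV D" "\<And>t. D (circle_of_real t) = G t - F t"
    by (rule circle_function_of_periodic) auto
  let ?h = "\<lambda>z. f (snd z) + circle_of_real (fst z * D (snd z))"
  have "continuous_on ({0..1} \<times> UNIV) ?h"
  proof (rule continuous_on_circle_add)
    show "continuous_on ({0..1::real} \<times> UNIV) (\<lambda>z. f (snd z))"
      by (rule continuous_on_compose2 [OF degree_lift_imp_continuous [OF F]])
         (auto intro!: continuous_intros)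
    have "continuous_on ({0..1::real} \<times> UNIV) (\<lambda>z. D (snd z))"
      by (rule continuous_on_compose2 [OF D(1)]) (auto intro!: continuous_intros)
    then have "continuous_on ({0..1} \<times> UNIV) (\<lambda>z. fst z * D (snd z))"
      by (intro continuous_intros)
    then show "continuous_on ({0..1} \<times> UNIV) (\<lambda>z. circle_of_real (fst z * D (snd z)))"
      by (rule continuous_on_compose2 [OF continuous_on_circle_of_real [of UNIV]]) auto
  qed
  moreover have "?h (0, x) = f x" for x
    by (simp flip: zero_circle.abs_eq)
  moreover have "?h (1, x) = g x" for x
  proof -
    obtain t where t: "x = circle_of_real t" by (rule circle_of_real_cases)
    show ?thesis
      using F G by (simp add: t D degree_lift_def flip: circle_of_real_add)
  qed
  ultimately show ?thesis
    unfolding homotopic_with_def prod_topology_subtopology_eu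
    by (intro exI [of _ ?h]) auto
qed

text \<open>Lift the homotopy to the square. Its endpoints stay fixed in the circle, so the lift is
  constant on the two sides where only the homotopy parameter varies; the other two sides are
  translates of \<open>P\<close> and \<open>Q\<close>, which therefore have the same
  displacement.\<close>

lemma homotopic_paths_lift:
  assumes "continuous_on {0..1} P" "continuous_on {0..1} Q"
    and "homotopic_paths UNIV (\<lambda>t. circle_of_real (P t)) (\<lambda>t. circle_of_real (Q t))"
  shows "P 1 - P 0 = Q 1 - Q 0"
proof -
  let ?I = "{0..1::real}"
  obtain h where h: "continuous_on (?I \<times> ?I) h"
      "\<And>t. t \<in> ?I \<Longrightarrow> h (0, t) = circle_of_real (P t)"
      "\<And>t. t \<in> ?I \<Longrightarrow> h (1, t) = circle_of_real (Q t)"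
      "\<And>s. s \<in> ?I \<Longrightarrow> h (s, 0) = circle_of_real (P 0)"
      "\<And>s. s \<in> ?I \<Longrightarrow> h (s, 1) = circle_of_real (P 1)"
    using assms(3) unfolding homotopic_paths pathstart_def pathfinish_def by auto
  have conv: "convex (?I \<times> ?I)" by (intro convex_Times) auto
  obtain K where K: "continuous_on (?I \<times> ?I) K" "\<And>z. z \<in> ?I \<times> ?I \<Longrightarrow> h z = circle_of_real (K z)"
    using circle_lift [OF h(1) convex_imp_contractible [OF conv]] by blast
  \<comment> \<open>Two lifts of one path differ by a constant; this is applied below to each of the
    four sides of the square.\<close>
  have const: "u 1 - v 1 = u 0 - v 0"
    if "continuous_on ?I u" "continuous_on ?I v"
      "\<And>t. t \<in> ?I \<Longrightarrow> circle_of_real (u t) = circle_of_real (v t)" for u v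
  proof -
    have "(\<lambda>t. u t - v t) constant_on ?I"
      by (rule continuous_on_integer_valued_constant)
         (use that in \<open>auto simp: circle_of_real_eq_iff intro!: continuous_intros\<close>)
    then show ?thesis by (auto simp: constant_on_def)
  qed
  have cont: "continuous_on ?I (\<lambda>t. K (t, c))" "continuous_on ?I (\<lambda>t. K (c, t))" if "c \<in> ?I" for c
    by (rule continuous_on_compose2 [OF K(1)]; use that in \<open>auto intro!: continuous_intros\<close>)+
  have "K (0, 1) - P 1 = K (0, 0) - P 0"
    using const [of "\<lambda>t. K (0, t)" P] cont [of 0] assms(1) K(2) h(2) by auto
  moreover have "K (1, 1) - Q 1 = K (1, 0) - Q 0"
    using const [of "\<lambda>t. K (1, t)" Q] cont [of 1] assms(2) K(2) h(3) by auto
  moreover have "K (1, 0) = K (0, 0)"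
    using const [of "\<lambda>t. K (t, 0)" "\<lambda>_. P 0"] cont [of 0] K(2) h(4) by auto
  moreover have "K (1, 1) = K (0, 1)"
    using const [of "\<lambda>t. K (t, 1)" "\<lambda>_. P 1"] cont [of 1] K(2) h(5) by auto
  ultimately show ?thesis by linarith
qed

text \<open>The translate \<open>Q - n\<close> covers the same path as \<open>Q\<close> and has the
  endpoints of \<open>P\<close>, so the straight-line homotopy between the lifts projects to one
  with fixed endpoints.\<close>

lemma homotopic_paths_of_lift:
  assumes P: "continuous_on {0..1} P" and Q: "continuous_on {0..1} Q"
    and "Q 0 - P 0 = of_int n" "Q 1 - P 1 = of_int n"
  shows "homotopic_paths UNIV (\<lambda>t. circle_of_real (P t)) (\<lambda>t. circle_of_real (Q t))"
proof -
  let ?I = "{0..1::real}"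
  let ?K = "\<lambda>z. P (snd z) + fst z * (Q (snd z) - of_int n - P (snd z))"
  have "continuous_on (?I \<times> ?I) (\<lambda>z. P (snd z))" "continuous_on (?I \<times> ?I) (\<lambda>z. Q (snd z))"
    by (rule continuous_on_compose2 [OF P] continuous_on_compose2 [OF Q];
        auto intro!: continuous_intros)+
  then have "continuous_on (?I \<times> ?I) ?K"
    by (intro continuous_intros)
  then have "continuous_on (?I \<times> ?I) (\<lambda>z. circle_of_real (?K z))"
    by (rule continuous_on_compose2 [OF continuous_on_circle_of_real [of UNIV]]) auto
  moreover have "Q 0 - of_int n = P 0" "Q 1 - of_int n = P 1"
    using assms by linarith+
  ultimately show ?thesis
    unfolding homotopic_paths pathstart_def pathfinish_def
    by (intro exI [of _ "\<lambda>z. circle_of_real (?K z)"]) (auto simp: circle_of_real_eq_iff)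
qed

lemma path_circle_lift:
  assumes "path \<gamma>"
  obtains p where "continuous_on {0..1} p" "\<And>t. t \<in> {0..1} \<Longrightarrow> \<gamma> t = circle_of_real (p t)"
  using circle_lift [of "{0..1}" \<gamma>] assms convex_imp_contractible [of "{0..1::real}"]
  unfolding path_def by auto

text \<open>Test on the generator, the loop at 0 with \<open>k = 1\<close>: its image lifts to
  \<open>F\<close>, of displacement \<open>b\<close>, while the loop prescribed by the hypothesis
  lifts to a path of displacement \<open>a\<close>.\<close>

lemma pi1_multiplication_degree_lift:
  assumes "pi1_multiplication f a" and F: "degree_lift f F b"
  shows "a = b"
proof -
  have path: "path (circle_loop 0 1)"
    unfolding path_def circle_loop_def
    by (intro continuous_on_circle_add continuous_intros
        continuous_on_compose2 [OF continuous_on_circle_of_real [of UNIV]]) auto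
  then have "homotopic_paths UNIV (f \<circ> circle_loop 0 1) (circle_loop (f 0) (a * 1))"
    using assms(1) unfolding pi1_multiplication_def
    by (meson homotopic_paths_refl subset_UNIV)
  moreover have "f \<circ> circle_loop 0 1 = (\<lambda>t. circle_of_real (F t))"
    using F by (auto simp: circle_loop_def degree_lift_def)
  moreover have "circle_loop (f 0) (a * 1) = (\<lambda>t. circle_of_real (F 0 + of_int a * t))"
    using F by (simp add: circle_loop_def degree_lift_def circle_of_real_add zero_circle.abs_eq)
  ultimately have "homotopic_paths UNIV (\<lambda>t. circle_of_real (F t))
      (\<lambda>t. circle_of_real (F 0 + of_int a * t))"
    by simp
  moreover have "continuous_on {0..1} F"
    using F by (auto simp: degree_lift_def intro: continuous_on_subset)
  moreover have "continuous_on {0..1} (\<lambda>t. F 0 + of_int a * t)"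
    by (intro continuous_intros)
  ultimately have "F 1 - F 0 = of_int a"
    using homotopic_paths_lift by fastforce
  moreover have "F 1 = F 0 + of_int b"
    using F unfolding degree_lift_def by (metis add_0)
  ultimately show ?thesis by simp
qed

section \<open>Local degree and sign changes\<close>

lemma circle_log_of_real:
  assumes "\<bar>t\<bar> < 1/2"
  shows "circle_log (circle_of_real t) = t"
  unfolding circle_log_def
proof (rule the_equality)
  show "- 1 / 2 < t \<and> t \<le> 1 / 2 \<and> circle_of_real t = circle_of_real t"
    using assms by auto
  fix s assume s: "- 1 / 2 < s \<and> s \<le> 1 / 2 \<and> circle_of_real s = circle_of_real t"
  then obtain n where n: "s - t = of_int n"
    by (auto simp: circle_of_real_eq_iff elim: Ints_cases)
  have "\<bar>s - t\<bar> < 1" using s assms by linarith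
  then have "n = 0" unfolding n by linarith
  with n show "s = t" by simp
qed

text \<open>A self-map of the two-point sphere is constant, the identity or the reflection, with
  degree 0, 1 or -1. In each case the degree is half the difference of the two values.\<close>

lemma Brouwer_degree2_0:
  fixes u :: "real \<Rightarrow> real"
  assumes "u 1 \<in> {-1, 1}" "u (-1) \<in> {-1, 1}"
  shows "2 * of_int (Brouwer_degree2 0 (\<lambda>x i. if i = 0 then u (x 0) else 0)) = u 1 - u (-1)"
proof -
  have x: "x 0 = 1 \<or> x 0 = -1" "i \<noteq> 0 \<Longrightarrow> x i = 0" if "x \<in> topspace (nsphere 0)" for x i
    using that by (auto simp: nsphere power2_eq_1_iff)
  let ?u = "\<lambda>x i. if i = (0::nat) then u (x (0::nat)) else 0"
  consider "u 1 = u (-1)" | "u 1 = 1" "u (-1) = -1" | "u 1 = -1" "u (-1) = 1"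
    using assms by auto
  then show ?thesis
  proof cases
    case 1
    have "Brouwer_degree2 0 ?u = Brouwer_degree2 0 (\<lambda>x i. if i = 0 then u 1 else 0)"
      by (rule Brouwer_degree2_eq) (use 1 x in fastforce)
    then show ?thesis using 1 by (simp add: Brouwer_degree2_const)
  next
    case 2
    have "Brouwer_degree2 0 ?u = Brouwer_degree2 0 id"
      by (rule Brouwer_degree2_eq) (use 2 x in \<open>fastforce simp: fun_eq_iff\<close>)
    then show ?thesis using 2 by simp
  next
    case 3
    have "Brouwer_degree2 0 ?u = Brouwer_degree2 0 (\<lambda>x i. if i = 0 then - x i else x i)"
      by (rule Brouwer_degree2_eq) (use 3 x in \<open>fastforce simp: fun_eq_iff\<close>)
    then show ?thesis using 3 by (simp add: Brouwer_degree2_reflection)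
  qed
qed

text \<open>The local degree of \<open>H\<close> at \<open>t\<close> in a lifted coordinate;
  doubling avoids a division and matches \<open>Brouwer_degree2_0\<close>.\<close>

definition sign_jump :: "(real \<Rightarrow> real) \<Rightarrow> real \<Rightarrow> int \<Rightarrow> bool"
  where "sign_jump H t d \<longleftrightarrow>
    (\<forall>\<^sub>F \<epsilon> in at_right 0. 2 * of_int d = sgn (H (t + \<epsilon>)) - sgn (H (t - \<epsilon>)))"

lemma sgn_constant_if_no_zero:
  fixes H :: "real \<Rightarrow> real"
  assumes "continuous_on {a..b} H" "\<And>t. t \<in> {a..b} \<Longrightarrow> H t \<noteq> 0" "a \<le> b"
  shows "sgn (H a) = sgn (H b)"
proof (rule ccontr)
  assume ne: "sgn (H a) \<noteq> sgn (H b)"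
  have "H a \<noteq> 0" "H b \<noteq> 0" using assms by auto
  with ne consider "H a < 0" "0 < H b" | "0 < H a" "H b < 0"
    by (auto simp: sgn_if split: if_splits)
  then have "\<exists>t. a \<le> t \<and> t \<le> b \<and> H t = 0"
    using IVT' [of H a 0 b] IVT2' [of H b 0 a] assms by cases auto
  with assms show False by auto
qed

lemma isolated_eventually_nonzero:
  fixes H :: "real \<Rightarrow> real"
  assumes "finite ({t - 1..t + 1} \<inter> {s. H s = 0})"
  shows "\<forall>\<^sub>F \<epsilon> in at_right 0. \<forall>s. 0 < \<bar>s - t\<bar> \<and> \<bar>s - t\<bar> \<le> \<epsilon> \<longrightarrow> H s \<noteq> 0"
proof -
  let ?Z = "({t - 1..t + 1} \<inter> {s. H s = 0}) - {t}"
  have "finite ?Z" using assms by simp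
  then obtain e where e: "e > 0" "\<And>s. s \<in> ?Z \<Longrightarrow> e \<le> dist t s"
    using finite_set_avoid [of ?Z t] by blast
  have "H s \<noteq> 0" if "0 < \<bar>s - t\<bar>" "\<bar>s - t\<bar> \<le> \<epsilon>" "\<epsilon> < min e 1" for s \<epsilon>
  proof
    assume "H s = 0"
    then have "s \<in> ?Z" using that by auto
    from e(2) [OF this] that show False by (auto simp: dist_real_def)
  qed
  then show ?thesis
    using e(1) unfolding eventually_at_right_field
    by (intro exI [of _ "min e 1"]) auto
qed

text \<open>A punctured neighbourhood of \<open>t\<close> is free of zeros, and by the intermediate
  value theorem the sign cannot change on either half of it.\<close>

lemma eventually_sgn_at_isolated_zero:
  fixes H :: "real \<Rightarrow> real"
  assumes H: "continuous_on UNIV H" and fin: "finite ({t - 1..t + 1} \<inter> {s. H s = 0})"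
  obtains r l where "r \<in> {-1, 1}" "l \<in> {-1, 1}"
    "\<forall>\<^sub>F \<epsilon> in at_right 0. sgn (H (t + \<epsilon>)) = r \<and> sgn (H (t - \<epsilon>)) = l"
proof -
  from isolated_eventually_nonzero [OF fin] obtain e where e: "e > 0"
      "\<And>s \<epsilon>. 0 < \<bar>s - t\<bar> \<Longrightarrow> \<bar>s - t\<bar> \<le> \<epsilon> \<Longrightarrow> 0 < \<epsilon> \<Longrightarrow> \<epsilon> < e \<Longrightarrow> H s \<noteq> 0"
    unfolding eventually_at_right_field by blast
  define d where "d = e / 2"
  have d: "0 < d" "d < e" using e(1) by (auto simp: d_def)
  have nz: "H s \<noteq> 0" if "s \<noteq> t" "\<bar>s - t\<bar> \<le> d" for s
    using e(2) [of s d] that d by auto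
  have c: "continuous_on A H" for A
    using H by (rule continuous_on_subset) auto
  show thesis
  proof (rule that [of "sgn (H (t + d))" "sgn (H (t - d))"])
    show "sgn (H (t + d)) \<in> {-1, 1}" "sgn (H (t - d)) \<in> {-1, 1}"
      using nz [of "t + d"] nz [of "t - d"] d by (auto simp: sgn_if)
    have "sgn (H (t + \<epsilon>)) = sgn (H (t + d)) \<and> sgn (H (t - \<epsilon>)) = sgn (H (t - d))"
      if "0 < \<epsilon>" "\<epsilon> < d" for \<epsilon>
    proof
      show "sgn (H (t + \<epsilon>)) = sgn (H (t + d))"
        by (rule sgn_constant_if_no_zero [OF c]; (rule nz)?) (use that in auto)
      have "sgn (H (t - d)) = sgn (H (t - \<epsilon>))"
        by (rule sgn_constant_if_no_zero [OF c]; (rule nz)?) (use that in auto)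
      then show "sgn (H (t - \<epsilon>)) = sgn (H (t - d))" ..
    qed
    then show "\<forall>\<^sub>F \<epsilon> in at_right 0. sgn (H (t + \<epsilon>)) = sgn (H (t + d)) \<and> sgn (H (t - \<epsilon>)) = sgn (H (t - d))"
      using d(1) unfolding eventually_at_right_field by blast
  qed
qed

text \<open>Close to \<open>t\<close> the lift moves by less than 1/2, so \<open>circle_log\<close>
  returns exactly the difference of lifted values. The map on the small sphere then records the
  signs of this difference on the two sides of \<open>t\<close>.\<close>

lemma local_degree_eq_sign_jump:
  assumes \<Phi>: "continuous_on UNIV \<Phi>" and \<phi>: "\<And>t. \<phi> (circle_of_real t) = circle_of_real (\<Phi> t)"
    and fin: "finite ({t - 1..t + 1} \<inter> {s. \<Phi> s = \<Phi> t})"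
  shows "sign_jump (\<lambda>s. \<Phi> s - \<Phi> t) t (local_degree \<phi> (circle_of_real t))"
proof -
  let ?H = "\<lambda>s. \<Phi> s - \<Phi> t"
  let ?u = "\<lambda>\<epsilon> y. sgn (circle_log (\<phi> (circle_of_real t + circle_of_real (\<epsilon> * y)) - \<phi> (circle_of_real t)))"
  let ?D = "\<lambda>\<epsilon>. Brouwer_degree2 0 (\<lambda>x i. if i = 0 then ?u \<epsilon> (x 0) else 0)"
  have H: "continuous_on UNIV ?H" using \<Phi> by (intro continuous_intros)
  obtain r l where rl: "r \<in> {-1, 1}" "l \<in> {-1, 1}"
    and ev: "\<forall>\<^sub>F \<epsilon> in at_right 0. sgn (?H (t + \<epsilon>)) = r \<and> sgn (?H (t - \<epsilon>)) = l"
    by (rule eventually_sgn_at_isolated_zero [OF H, of t]) (use fin in auto)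
  define d :: int where "d = (if r = l then 0 else if r = 1 then 1 else -1)"
  have d: "2 * of_int d = r - l" using rl by (auto simp: d_def)
  have "(\<Phi> \<longlongrightarrow> \<Phi> t) (at t)"
    using \<Phi> by (simp add: continuous_on_eq_continuous_at isCont_def)
  then have "\<forall>\<^sub>F s in at t. dist (\<Phi> s) (\<Phi> t) < 1/2"
    by (rule tendstoD) simp
  then obtain e where e: "e > 0" "\<And>s. s \<noteq> t \<Longrightarrow> dist s t < e \<Longrightarrow> \<bar>?H s\<bar> < 1/2"
    by (auto simp: eventually_at dist_real_def)
  have "\<forall>\<^sub>F \<epsilon> in at_right (0::real). 0 < \<epsilon> \<and> \<epsilon> < e"
    using e(1) unfolding eventually_at_right_field by blast
  with ev have "\<forall>\<^sub>F \<epsilon> in at_right 0. ?D \<epsilon> = d"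
  proof eventually_elim
    case (elim \<epsilon>)
    have u: "?u \<epsilon> y = sgn (?H (t + \<epsilon> * y))" if "y \<in> {-1, 1}" for y
    proof -
      have "\<bar>?H (t + \<epsilon> * y)\<bar> < 1/2"
        by (rule e(2)) (use elim that in \<open>auto simp: dist_real_def\<close>)
      then show ?thesis
        by (simp add: \<phi> circle_log_of_real flip: circle_of_real_add circle_of_real_diff)
    qed
    have u1: "?u \<epsilon> 1 = r" "?u \<epsilon> (-1) = l"
      using u [of 1] u [of "-1"] elim by auto
    have "2 * of_int (?D \<epsilon>) = ?u \<epsilon> 1 - ?u \<epsilon> (-1)"
      by (rule Brouwer_degree2_0) (use u1 rl in auto)
    then have "2 * real_of_int (?D \<epsilon>) = 2 * of_int d"
      unfolding u1 d .
    then show ?case by simp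
  qed
  \<comment> \<open>The value in \<open>local_degree\<close> is unique because the filter of small
    positive radii is nontrivial.\<close>
  then have "local_degree \<phi> (circle_of_real t) = d"
    unfolding local_degree_def
  proof (rule the_equality)
    fix d' assume "\<forall>\<^sub>F \<epsilon> in at_right 0. ?D \<epsilon> = d'"
    with \<open>\<forall>\<^sub>F \<epsilon> in at_right 0. ?D \<epsilon> = d\<close> have "\<forall>\<^sub>F \<epsilon> in at_right (0::real). d' = d"
      by eventually_elim simp
    then show "d' = d" by (simp add: trivial_limit_at_right_real)
  qed
  moreover have "sign_jump ?H t d"
    unfolding sign_jump_def using ev by eventually_elim (simp add: d)
  ultimately show ?thesis by simp
qed

lemma sign_jump_unique:
  assumes "sign_jump H t d" "sign_jump H t d'"
  shows "d = d'"
proof -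
  have "\<forall>\<^sub>F \<epsilon> in at_right (0::real). d = d'"
    using assms unfolding sign_jump_def by eventually_elim simp
  then show ?thesis by simp
qed

lemma orientation_preserving_half_turn: "orientation_preserving half_turn"
  unfolding orientation_preserving_def
proof
  fix c
  obtain t where t: "c = circle_of_real t" by (rule circle_of_real_cases)
  have "sign_jump (\<lambda>s. (s + 1/2) - (t + 1/2)) t (local_degree half_turn c)"
    unfolding t
    by (rule local_degree_eq_sign_jump)
       (auto intro!: continuous_intros simp: circle_of_real_add_half)
  moreover have "sign_jump (\<lambda>s. (s + 1/2) - (t + 1/2)) t 1"
    unfolding sign_jump_def using eventually_at_right_less
    by eventually_elim simp
  ultimately show "local_degree half_turn c = 1"
    by (rule sign_jump_unique)
qed

text \<open>Dimension 1 is odd and the half turn preserves orientation, so only the parity and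
  absolute value cases of \<open>pseudo_index\<close> arise.\<close>

lemma type_A_half_turn: "type_A 1 half_turn"
  by (simp add: type_A_def orientation_preserving_half_turn)

text \<open>The sign of \<open>H\<close> is constant between consecutive zeros, so the jumps
  telescope. The induction splits off the largest zero \<open>z\<close>.\<close>

lemma sum_sign_jumps:
  fixes H :: "real \<Rightarrow> real" and d :: "real \<Rightarrow> int"
  assumes H: "continuous_on UNIV H" and "a \<le> b" "H a \<noteq> 0" "H b \<noteq> 0"
    and "finite {t \<in> {a..b}. H t = 0}"
    and "\<And>t. t \<in> {a..b} \<Longrightarrow> H t = 0 \<Longrightarrow> sign_jump H t (d t)"
  shows "2 * of_int (\<Sum>t | t \<in> {a..b} \<and> H t = 0. d t) = sgn (H b) - sgn (H a)"
  using assms(2-)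
proof (induction "card {t \<in> {a..b}. H t = 0}" arbitrary: b)
  case 0
  then have "{t \<in> {a..b}. H t = 0} = {}" by simp
  moreover from this have "sgn (H a) = sgn (H b)"
    using 0 by (intro sgn_constant_if_no_zero continuous_on_subset [OF H]) auto
  ultimately show ?case by (metis diff_self of_int_0 mult_zero_right sum.empty)
next
  case (Suc n)
  let ?Z = "{t \<in> {a..b}. H t = 0}"
  have ne: "?Z \<noteq> {}" using Suc.hyps(2) by (metis card.empty nat.simps(3))
  define z where "z = Max ?Z"
  have z: "z \<in> ?Z" unfolding z_def using ne Suc.prems(4) by (rule Max_in [rotated])
  have zmax: "t \<le> z" if "t \<in> ?Z" for t
    unfolding z_def using Suc.prems(4) that by (rule Max_ge)
  have zab: "a < z" "z < b" using z Suc.prems by (auto simp: less_le)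
  let ?Z' = "?Z - {z}"
  \<comment> \<open>Choose \<open>\<epsilon>\<close> so small that \<open>z - \<epsilon>\<close> and
    \<open>z + \<epsilon>\<close> lie inside the interval, all other zeros lie left of
    \<open>z - \<epsilon>\<close>, and the jump at \<open>z\<close> is seen at this radius.\<close>
  have "\<forall>\<^sub>F \<epsilon> in at_right 0. 0 < \<epsilon> \<and> \<epsilon> < z - a \<and> \<epsilon> < b - z"
    unfolding eventually_at_right_field
    by (intro exI [of _ "min (z - a) (b - z)"]) (use zab in auto)
  moreover have "\<forall>\<^sub>F \<epsilon> in at_right 0. \<forall>t \<in> ?Z'. t < z - \<epsilon>"
  proof (rule eventually_ball_finite)
    show "finite ?Z'" using Suc.prems(4) by simp
    show "\<forall>t\<in>?Z'. \<forall>\<^sub>F \<epsilon> in at_right 0. t < z - \<epsilon>"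
    proof
      fix t assume "t \<in> ?Z'"
      then have "t < z" using zmax [of t] by auto
      then show "\<forall>\<^sub>F \<epsilon> in at_right 0. t < z - \<epsilon>"
        unfolding eventually_at_right_field by (intro exI [of _ "z - t"]) auto
    qed
  qed
  moreover have "\<forall>\<^sub>F \<epsilon> in at_right 0. 2 * of_int (d z) = sgn (H (z + \<epsilon>)) - sgn (H (z - \<epsilon>))"
    using Suc.prems(5) [of z] z by (simp add: sign_jump_def)
  ultimately have "\<forall>\<^sub>F \<epsilon> in at_right 0. (0 < \<epsilon> \<and> \<epsilon> < z - a \<and> \<epsilon> < b - z) \<and> (\<forall>t \<in> ?Z'. t < z - \<epsilon>) \<and>
      2 * of_int (d z) = sgn (H (z + \<epsilon>)) - sgn (H (z - \<epsilon>))"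
    by eventually_elim auto
  then obtain \<epsilon> where \<epsilon>: "0 < \<epsilon>" "\<epsilon> < z - a" "\<epsilon> < b - z" "\<And>t. t \<in> ?Z' \<Longrightarrow> t < z - \<epsilon>"
      "2 * of_int (d z) = sgn (H (z + \<epsilon>)) - sgn (H (z - \<epsilon>))"
    using eventually_happens' [OF trivial_limit_at_right_real] by blast
  have Z': "{t \<in> {a..z - \<epsilon>}. H t = 0} = ?Z'"
    using \<epsilon> by force
  have right: "sgn (H (z + \<epsilon>)) = sgn (H b)"
  proof (rule sgn_constant_if_no_zero [OF continuous_on_subset [OF H]])
    fix t assume "t \<in> {z + \<epsilon>..b}"
    then show "H t \<noteq> 0" using zmax [of t] \<epsilon> zab by auto
  qed (use \<epsilon> in auto)
  have "2 * of_int (\<Sum>t | t \<in> {a..z - \<epsilon>} \<and> H t = 0. d t) = sgn (H (z - \<epsilon>)) - sgn (H a)"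
  proof (rule Suc.hyps(1))
    show "n = card {t \<in> {a..z - \<epsilon>}. H t = 0}"
      unfolding Z' using Suc.hyps(2) z Suc.prems(4) by simp
    show "H (z - \<epsilon>) \<noteq> 0"
    proof
      assume "H (z - \<epsilon>) = 0"
      then have "z - \<epsilon> \<in> ?Z'" using \<epsilon> by auto
      from \<epsilon>(4) [OF this] show False by simp
    qed
    show "finite {t \<in> {a..z - \<epsilon>}. H t = 0}"
      unfolding Z' using Suc.prems(4) by simp
  qed (use Suc.prems \<epsilon> in auto)
  then have "2 * of_int (\<Sum>t\<in>?Z'. d t) = sgn (H (z - \<epsilon>)) - sgn (H a)"
    unfolding Z' .
  moreover have "(\<Sum>t\<in>?Z. d t) = d z + (\<Sum>t\<in>?Z'. d t)"
    using Suc.prems(4) z by (rule sum.remove)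
  ultimately show ?case using \<epsilon>(5) right by simp
qed

section \<open>Borsuk-Ulam classes in terms of a lift\<close>

text \<open>The fibre of the projection over a point is a translate of the integers, which meets a
  bounded interval in finitely many points.\<close>

lemma finite_interval_circle_preimage:
  assumes "finite A"
  shows "finite {s \<in> {\<alpha>..\<beta>}. circle_of_real s \<in> A}"
proof -
  have "finite {s \<in> {\<alpha>..\<beta>}. circle_of_real s = x}" for x
  proof -
    obtain t where t: "x = circle_of_real t" by (rule circle_of_real_cases)
    have "{s \<in> {\<alpha>..\<beta>}. circle_of_real s = x} \<subseteq> (\<lambda>n. t + of_int n) ` {\<lfloor>\<alpha> - t\<rfloor>..\<lceil>\<beta> - t\<rceil>}"
    proof
      fix s assume "s \<in> {s \<in> {\<alpha>..\<beta>}. circle_of_real s = x}"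
      then have s: "s \<in> {\<alpha>..\<beta>}" "circle_of_real s = x" by auto
      then obtain n where n: "s - t = of_int n"
        by (auto simp: t circle_of_real_eq_iff elim: Ints_cases)
      have "\<alpha> - t \<le> of_int n" "of_int n \<le> \<beta> - t"
        using s(1) by (auto simp flip: n)
      then have "n \<in> {\<lfloor>\<alpha> - t\<rfloor>..\<lceil>\<beta> - t\<rceil>}"
        by (auto simp: floor_le_iff le_ceiling_iff)
      moreover have "s = t + of_int n" using n by simp
      ultimately show "s \<in> (\<lambda>n. t + of_int n) ` {\<lfloor>\<alpha> - t\<rfloor>..\<lceil>\<beta> - t\<rceil>}" by blast
    qed
    then show ?thesis by (rule finite_subset) simp
  qed
  moreover have "{s \<in> {\<alpha>..\<beta>}. circle_of_real s \<in> A} = (\<Union>x\<in>A. {s \<in> {\<alpha>..\<beta>}. circle_of_real s = x})"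
    by auto
  ultimately show ?thesis using assms by simp
qed

lemma circle_of_real_in_interval:
  obtains t where "t \<in> {\<alpha>..<\<alpha> + 1}" "x = circle_of_real t"
proof -
  obtain s where s: "x = circle_of_real s" by (rule circle_of_real_cases)
  show thesis
  proof (rule that [of "\<alpha> + frac (s - \<alpha>)"])
    show "\<alpha> + frac (s - \<alpha>) \<in> {\<alpha>..<\<alpha> + 1}"
      by (simp add: frac_ge_0 frac_lt_1)
    show "x = circle_of_real (\<alpha> + frac (s - \<alpha>))"
      by (simp add: s circle_of_real_eq_iff frac_def)
  qed
qed

lemma circle_of_real_eq_imp_eq:
  assumes "circle_of_real s = circle_of_real t" "\<bar>s - t\<bar> < 1"
  shows "s = t"
proof -
  obtain n where n: "s - t = of_int n"
    using assms(1) by (auto simp: circle_of_real_eq_iff elim: Ints_cases)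
  with assms(2) have "n = 0" by linarith
  with n show ?thesis by simp
qed

locale circle_map_lift =
  fixes f :: "circle \<Rightarrow> circle" and F :: "real \<Rightarrow> real" and a :: int
  assumes degree_lift: "degree_lift f F a"
begin

definition G :: "real \<Rightarrow> real"
  where "G t = F (t + 1/2) - F t"

lemma f_of_real: "f (circle_of_real t) = circle_of_real (F t)"
  using degree_lift by (simp add: degree_lift_def)

lemma continuous_F: "continuous_on A F"
  using degree_lift by (auto simp: degree_lift_def intro: continuous_on_subset)

lemma continuous_G: "continuous_on A G"
  unfolding G_def [abs_def]
  by (intro continuous_intros continuous_F continuous_on_compose2 [OF continuous_F [of UNIV]]) auto

lemma G_add_int: "G (t + of_int n) = G t"
  using degree_lift_translate [OF degree_lift, of "t + 1/2" n]
    degree_lift_translate [OF degree_lift, of t n]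
  by (simp add: G_def algebra_simps)

lemma G_add_half: "G (t + 1/2) = of_int a - G t"
  using degree_lift_translate [OF degree_lift, of t 1]
  by (simp add: G_def algebra_simps)

text \<open>The function \<open>G\<close> descended to the circle; by \<open>G_add_int\<close> the
  chosen representative does not affect the value.\<close>

definition level :: "circle \<Rightarrow> real"
  where "level x = G (SOME t. circle_of_real t = x)"

lemma level_of_real: "level (circle_of_real t) = G t"
proof -
  have "circle_of_real (SOME s. circle_of_real s = circle_of_real t) = circle_of_real t"
    by (rule someI_ex) blast
  then obtain n where "(SOME s. circle_of_real s = circle_of_real t) - t = of_int n"
    unfolding circle_of_real_eq_iff by (rule Ints_cases)
  then have "(SOME s. circle_of_real s = circle_of_real t) = t + of_int n" by simp
  then show ?thesis by (simp only: level_def G_add_int)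
qed

lemma level_half_turn: "level (half_turn x) = of_int a - level x"
  by (rule circle_of_real_cases [of x])
     (simp add: level_of_real G_add_half flip: circle_of_real_add_half)

abbreviation coins :: "circle set"
  where "coins \<equiv> Coin f (f \<circ> half_turn)"

lemma coins_iff: "x \<in> coins \<longleftrightarrow> level x \<in> \<int>"
proof -
  obtain t where t: "x = circle_of_real t" by (rule circle_of_real_cases)
  have "x \<in> coins \<longleftrightarrow> F t - F (t + 1/2) \<in> \<int>"
    by (simp add: Coin_def t f_of_real circle_of_real_eq_iff flip: circle_of_real_add_half)
  also have "\<dots> \<longleftrightarrow> level x \<in> \<int>"
    by (metis G_def Ints_minus level_of_real minus_diff_eq t)
  finally show ?thesis .
qed

lemma half_turn_coins_iff: "half_turn x \<in> coins \<longleftrightarrow> x \<in> coins"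
  by (auto simp: Coin_def half_turn_involution)

text \<open>If \<open>p\<close> lifts a path, its images under \<open>f\<close> and
  \<open>f \<circ> half_turn\<close> lift to \<open>F (p t)\<close> and
  \<open>F (p t + 1/2)\<close>. These are homotopic only if their displacements agree, that is, if
  \<open>G\<close> takes the same value at both ends of \<open>p\<close>.\<close>

lemma Nielsen_rel_iff:
  assumes "x \<in> coins"
  shows "Nielsen_rel f (f \<circ> half_turn) x y \<longleftrightarrow> level x = level y"
proof
  assume "Nielsen_rel f (f \<circ> half_turn) x y"
  then obtain \<gamma> where \<gamma>: "path \<gamma>" "\<gamma> 0 = x" "\<gamma> 1 = y"
      "homotopic_paths UNIV (f \<circ> \<gamma>) (f \<circ> half_turn \<circ> \<gamma>)"
    by (auto simp: Nielsen_rel_def pathstart_def pathfinish_def)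
  obtain p where p: "continuous_on {0..1} p" "\<And>t. t \<in> {0..1} \<Longrightarrow> \<gamma> t = circle_of_real (p t)"
    using path_circle_lift [OF \<gamma>(1)] by blast
  have "continuous_on {0..1} (\<lambda>t. F (p t))" "continuous_on {0..1} (\<lambda>t. F (p t + 1/2))"
    by (rule continuous_on_compose2 [OF continuous_F [of UNIV]]; use p in \<open>auto intro!: continuous_intros\<close>)+
  moreover have "homotopic_paths UNIV (\<lambda>t. circle_of_real (F (p t))) (\<lambda>t. circle_of_real (F (p t + 1/2)))"
  proof -
    have "path (f \<circ> \<gamma>)" "path (f \<circ> half_turn \<circ> \<gamma>)"
      using \<gamma>(4) homotopic_paths_imp_path by blast+
    then have "homotopic_paths UNIV (f \<circ> \<gamma>) (\<lambda>t. circle_of_real (F (p t)))"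
      "homotopic_paths UNIV (f \<circ> half_turn \<circ> \<gamma>) (\<lambda>t. circle_of_real (F (p t + 1/2)))"
      by (intro homotopic_paths_eq; simp add: p f_of_real flip: circle_of_real_add_half)+
    with \<gamma>(4) show ?thesis
      by (meson homotopic_paths_sym homotopic_paths_trans)
  qed
  ultimately have "F (p 1) - F (p 0) = F (p 1 + 1/2) - F (p 0 + 1/2)"
    by (rule homotopic_paths_lift)
  then have "G (p 0) = G (p 1)" by (simp add: G_def)
  moreover have "x = circle_of_real (p 0)" "y = circle_of_real (p 1)"
    using \<gamma>(2,3) p(2) [of 0] p(2) [of 1] by auto
  ultimately show "level x = level y"
    by (simp only: level_of_real)
next
  assume eq: "level x = level y"
  obtain n where n: "level x = of_int n"
    using assms unfolding coins_iff by (rule Ints_cases)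
  obtain s t where st: "x = circle_of_real s" "y = circle_of_real t"
    by (metis circle_of_real_cases)
  \<comment> \<open>Any path between the points would do; the segment between two lifts is used. At
    both of its ends the two lifted images differ by the same integer \<open>n\<close>.\<close>
  let ?p = "\<lambda>u. s + u * (t - s)"
  let ?\<gamma> = "\<lambda>u. circle_of_real (?p u)"
  have "path ?\<gamma>"
    unfolding path_def
    by (rule continuous_on_compose2 [OF continuous_on_circle_of_real [of UNIV]])
       (auto intro!: continuous_intros)
  moreover have "homotopic_paths UNIV (\<lambda>u. circle_of_real (F (?p u))) (\<lambda>u. circle_of_real (F (?p u + 1/2)))"
  proof (rule homotopic_paths_of_lift)
    show "continuous_on {0..1} (\<lambda>u. F (?p u))" "continuous_on {0..1} (\<lambda>u. F (?p u + 1/2))"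
      by (rule continuous_on_compose2 [OF continuous_F [of UNIV]]; auto intro!: continuous_intros)+
    show "F (?p 0 + 1/2) - F (?p 0) = of_int n" "F (?p 1 + 1/2) - F (?p 1) = of_int n"
      using n eq by (simp_all add: st level_of_real G_def)
  qed
  then have "homotopic_paths UNIV (f \<circ> ?\<gamma>) (f \<circ> half_turn \<circ> ?\<gamma>)"
    by (simp add: o_def f_of_real flip: circle_of_real_add_half)
  ultimately show "Nielsen_rel f (f \<circ> half_turn) x y"
    unfolding Nielsen_rel_def
    by (intro exI [of _ ?\<gamma>]) (auto simp: pathstart_def pathfinish_def st)
qed

lemma Nielsen_classes_eq: "Nielsen_classes f (f \<circ> half_turn) = (\<lambda>x. {y. level y = level x}) ` coins"
proof -
  have "{(x, y). x \<in> coins \<and> y \<in> coins \<and> Nielsen_rel f (f \<circ> half_turn) x y} `` {x} = {y. level y = level x}"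
    if "x \<in> coins" for x
    using that by (auto simp: Nielsen_rel_iff coins_iff)
  then show ?thesis
    unfolding Nielsen_classes_def quotient_def by (simp add: UNION_singleton_eq_range)
qed

text \<open>The other point of such an orbit has level \<open>a - m\<close>, so \<open>m\<close> and
  \<open>a - m\<close> describe the same set of orbits.\<close>

definition BU_level :: "real \<Rightarrow> circle set set"
  where "BU_level m = {P \<in> BUCoin f half_turn. \<exists>y\<in>P. level y = m}"

lemma BUCoinE:
  assumes "P \<in> BUCoin f half_turn" "z \<in> P"
  shows "P = {z, half_turn z}" "z \<in> coins"
  using assms by (auto simp: BUCoin_def half_turn_involution half_turn_coins_iff)

lemma BU_classes_eq: "BU_classes f half_turn = (\<lambda>x. BU_level (level x)) ` coins"
proof -
  let ?R = "{(P, Q). P \<in> BUCoin f half_turn \<and> Q \<in> BUCoin f half_turn \<and>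
                       (\<exists>x\<in>P. \<exists>y\<in>Q. Nielsen_rel f (f \<circ> half_turn) x y)}"
  have *: "?R `` {{x, half_turn x}} = BU_level (level x)" if x: "x \<in> coins" for x
  proof -
    have P: "{x, half_turn x} \<in> BUCoin f half_turn" using x by (auto simp: BUCoin_def)
    have "(\<exists>u\<in>{x, half_turn x}. \<exists>y\<in>Q. Nielsen_rel f (f \<circ> half_turn) u y) \<longleftrightarrow> (\<exists>y\<in>Q. level y = level x)"
      if Q: "Q \<in> BUCoin f half_turn" for Q
    proof -
      \<comment> \<open>A path may also start at the partner of \<open>x\<close>. If it ends at
        \<open>y\<close>, then the partner of \<open>y\<close> lies in the same orbit
        \<open>Q\<close> and has the level of \<open>x\<close>.\<close>
      have "\<exists>z\<in>Q. level z = level x" if "y \<in> Q" "level (half_turn x) = level y" for y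
      proof
        show "half_turn y \<in> Q" using BUCoinE [OF Q that(1)] by auto
        show "level (half_turn y) = level x"
          using that(2) by (simp add: level_half_turn)
      qed
      then show ?thesis
        using x by (simp add: Nielsen_rel_iff half_turn_coins_iff) metis
    qed
    then have "BU_level (level x) = {Q \<in> BUCoin f half_turn.
        \<exists>u\<in>{x, half_turn x}. \<exists>y\<in>Q. Nielsen_rel f (f \<circ> half_turn) u y}"
      unfolding BU_level_def by blast
    then show ?thesis using P by blast
  qed
  have "BU_classes f half_turn = (\<lambda>P. ?R `` {P}) ` BUCoin f half_turn"
    unfolding BU_classes_def quotient_def by blast
  also have "\<dots> = (\<lambda>P. ?R `` {P}) ` ((\<lambda>x. {x, half_turn x}) ` coins)"
    by (rule arg_cong [OF BUCoin_def])
  also have "\<dots> = (\<lambda>x. BU_level (level x)) ` coins"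
    unfolding image_image by (rule image_cong [OF refl *])
  finally show ?thesis .
qed

text \<open>A point and its partner are Nielsen equivalent exactly when their levels
  \<open>m\<close> and \<open>a - m\<close> coincide.\<close>

lemma single_class_BU_level_iff:
  assumes "x \<in> coins"
  shows "single_class f half_turn (BU_level (level x)) \<longleftrightarrow> 2 * level x = of_int a"
proof
  assume "single_class f half_turn (BU_level (level x))"
  then obtain P z y where P: "P \<in> BUCoin f half_turn" "z \<in> P" "y \<in> P" "level y = level x"
      "Nielsen_rel f (f \<circ> half_turn) z (half_turn z)"
    by (auto simp: single_class_def BU_level_def)
  have "2 * level z = of_int a"
    using P(5) BUCoinE [OF P(1,2)] by (simp add: Nielsen_rel_iff level_half_turn)
  moreover have "y = z \<or> y = half_turn z"
    using BUCoinE(1) [OF P(1,2)] P(3) by auto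
  ultimately have "2 * level y = of_int a"
    by (auto simp: level_half_turn)
  then show "2 * level x = of_int a" by (simp add: P)
next
  assume "2 * level x = of_int a"
  then have "Nielsen_rel f (f \<circ> half_turn) x (half_turn x)"
    using assms by (simp add: Nielsen_rel_iff level_half_turn)
  moreover have "{x, half_turn x} \<in> BU_level (level x)"
    using assms by (auto simp: BU_level_def BUCoin_def)
  ultimately show "single_class f half_turn (BU_level (level x))"
    unfolding single_class_def by blast
qed

end

section \<open>Indices and pseudo-indices for a finite coincidence set\<close>

locale finite_coin_lift = circle_map_lift +
  assumes finite_coins: "finite (Coin f (f \<circ> half_turn))"
begin

abbreviation index :: "circle \<Rightarrow> int"
  where "index \<equiv> coin_index f (f \<circ> half_turn)"

text \<open>Integrality of \<open>m\<close> makes all these points lifts of coincidences.\<close>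

lemma finite_level_set:
  assumes "m \<in> \<int>"
  shows "finite {s \<in> {\<alpha>..\<beta>}. G s = m}"
  by (rule finite_subset [OF _ finite_interval_circle_preimage [OF finite_coins]])
     (use assms in \<open>auto simp: coins_iff level_of_real\<close>)

text \<open>Supplies a point at which to cut the circle without hitting a crossing of the level
  \<open>m\<close>.\<close>

lemma exists_off_level:
  assumes "m \<in> \<int>"
  obtains \<alpha> where "G \<alpha> \<noteq> m"
proof -
  have "{0..1::real} \<noteq> {s \<in> {0..1}. G s = m}"
    using finite_level_set [OF assms, of 0 1] infinite_Icc [of "0::real" 1] by (metis zero_less_one)
  then show thesis using that by blast
qed

text \<open>The index is the local degree of \<open>f\<close> minus
  \<open>f \<circ> half_turn\<close>, which lifts to \<open>- G\<close>; hence the sign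
  \<open>m - G\<close> rather than \<open>G - m\<close>.\<close>

lemma sign_jump_index:
  assumes "G t = m" "m \<in> \<int>"
  shows "sign_jump (\<lambda>s. m - G s) t (index (circle_of_real t))"
proof -
  let ?\<Phi> = "\<lambda>s. F s - F (s + 1/2)"
  have "sign_jump (\<lambda>s. ?\<Phi> s - ?\<Phi> t) t (index (circle_of_real t))"
    unfolding coin_index_def
  proof (rule local_degree_eq_sign_jump)
    have "continuous_on UNIV (\<lambda>s. - G s)"
      by (intro continuous_intros continuous_G)
    then show "continuous_on UNIV ?\<Phi>" by (simp add: G_def [abs_def])
    show "f (circle_of_real s) - (f \<circ> half_turn) (circle_of_real s) = circle_of_real (?\<Phi> s)" for s
      by (simp add: f_of_real circle_of_real_diff flip: circle_of_real_add_half)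
    have "{t - 1..t + 1} \<inter> {s. ?\<Phi> s = ?\<Phi> t} = {s \<in> {t - 1..t + 1}. G s = m}"
      using assms(1) by (auto simp: G_def)
    then show "finite ({t - 1..t + 1} \<inter> {s. ?\<Phi> s = ?\<Phi> t})"
      using finite_level_set [OF assms(2)] by simp
  qed
  moreover have "(\<lambda>s. ?\<Phi> s - ?\<Phi> t) = (\<lambda>s. m - G s)"
    using assms(1) by (auto simp: G_def)
  ultimately show ?thesis by simp
qed

text \<open>By \<open>G_add_half\<close>, moving by 1/2 turns \<open>m - G\<close> into the negative
  of the corresponding function at level \<open>a - m\<close>. Hence the parity of the index is the
  same for both points of an orbit.\<close>

lemma index_half_turn:
  assumes "x \<in> coins"
  shows "index (half_turn x) = - index x"
proof -
  obtain t where t: "x = circle_of_real t" by (rule circle_of_real_cases)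
  define m where "m = G t"
  have m: "m \<in> \<int>" using assms by (simp add: coins_iff level_of_real t m_def)
  have "sign_jump (\<lambda>s. m - G s) t (index x)"
    unfolding t by (rule sign_jump_index) (simp_all add: m m_def [symmetric])
  then have "sign_jump (\<lambda>s. (of_int a - m) - G s) (t + 1/2) (- index x)"
    unfolding sign_jump_def
  proof eventually_elim
    case (elim \<epsilon>)
    have "of_int a - m - G (t + 1/2 + \<epsilon>) = - (m - G (t + \<epsilon>))"
      "of_int a - m - G (t + 1/2 - \<epsilon>) = - (m - G (t - \<epsilon>))"
      using G_add_half [of "t + \<epsilon>"] G_add_half [of "t - \<epsilon>"] by (simp_all add: algebra_simps)
    then have "sgn (of_int a - m - G (t + 1/2 + \<epsilon>)) = - sgn (m - G (t + \<epsilon>))"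
      "sgn (of_int a - m - G (t + 1/2 - \<epsilon>)) = - sgn (m - G (t - \<epsilon>))"
      by (simp_all only: sgn_minus)
    with elim show ?case by simp
  qed
  moreover have "sign_jump (\<lambda>s. (of_int a - m) - G s) (t + 1/2) (index (circle_of_real (t + 1/2)))"
    by (rule sign_jump_index) (use m in \<open>auto simp: G_add_half m_def\<close>)
  ultimately show ?thesis
    unfolding t circle_of_real_add_half by (metis sign_jump_unique)
qed

lemma sum_index_interval:
  assumes "m \<in> \<int>" "\<alpha> \<le> \<beta>" "G \<alpha> \<noteq> m" "G \<beta> \<noteq> m"
  shows "2 * of_int (\<Sum>t | t \<in> {\<alpha>..\<beta>} \<and> G t = m. index (circle_of_real t)) = sgn (m - G \<beta>) - sgn (m - G \<alpha>)"
proof -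
  have eq: "{t \<in> {\<alpha>..\<beta>}. m - G t = 0} = {t \<in> {\<alpha>..\<beta>}. G t = m}" by auto
  have "2 * of_int (\<Sum>t | t \<in> {\<alpha>..\<beta>} \<and> m - G t = 0. index (circle_of_real t)) = sgn (m - G \<beta>) - sgn (m - G \<alpha>)"
  proof (rule sum_sign_jumps)
    show "continuous_on UNIV (\<lambda>t. m - G t)" by (intro continuous_intros continuous_G)
    show "finite {t \<in> {\<alpha>..\<beta>}. m - G t = 0}"
      unfolding eq using assms(1) by (rule finite_level_set)
  qed (use assms in \<open>auto intro!: sign_jump_index\<close>)
  then show ?thesis unfolding eq .
qed

text \<open>A period cut at a point off the level contains each point of the class once, and
  \<open>m - G\<close> has the same sign at both ends.\<close>

lemma sum_index_Nielsen_class: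
  assumes "m \<in> \<int>"
  shows "(\<Sum>x | level x = m. index x) = 0"
proof -
  obtain \<alpha> where \<alpha>: "G \<alpha> \<noteq> m" using exists_off_level [OF assms] .
  have per: "G (\<alpha> + 1) = G \<alpha>" using G_add_int [of \<alpha> 1] by simp
  let ?Z = "{t \<in> {\<alpha>..\<alpha> + 1}. G t = m}"
  have "inj_on circle_of_real ?Z"
  proof (rule inj_onI)
    fix s t assume st: "s \<in> ?Z" "t \<in> ?Z" "circle_of_real s = circle_of_real t"
    then have "s \<noteq> \<alpha>" "s \<noteq> \<alpha> + 1" "t \<noteq> \<alpha>" "t \<noteq> \<alpha> + 1" using \<alpha> per by auto
    then have "\<bar>s - t\<bar> < 1" using st by auto
    with st show "s = t" by (blast intro: circle_of_real_eq_imp_eq)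
  qed
  moreover have "{x. level x = m} = circle_of_real ` ?Z"
  proof
    show "{x. level x = m} \<subseteq> circle_of_real ` ?Z"
    proof clarify
      fix x assume "m = level x"
      obtain t where "t \<in> {\<alpha>..<\<alpha> + 1}" "x = circle_of_real t"
        by (rule circle_of_real_in_interval)
      then show "x \<in> circle_of_real ` {t \<in> {\<alpha>..\<alpha> + 1}. G t = level x}"
        by (auto simp: level_of_real)
    qed
  qed (auto simp: level_of_real)
  ultimately have "(\<Sum>x | level x = m. index x) = (\<Sum>t\<in>?Z. index (circle_of_real t))"
    by (simp add: sum.reindex)
  moreover have "2 * real_of_int (\<Sum>t\<in>?Z. index (circle_of_real t)) = 0"
    using sum_index_interval [OF assms, of \<alpha> "\<alpha> + 1"] \<alpha> per by simp
  then have "(\<Sum>t\<in>?Z. index (circle_of_real t)) = 0"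
    by linarith
  ultimately show ?thesis by simp
qed

text \<open>Whichever Nielsen class the choice in \<open>pseudo_index\<close> selects, it is a full
  level set and its indices sum to 0.\<close>

lemma pseudo_index_double:
  assumes "x \<in> coins" "2 * level x \<noteq> of_int a"
  shows "pseudo_index f half_turn (BU_level (level x)) = 0"
proof -
  let ?Q = "\<lambda>D. D \<in> Nielsen_classes f (f \<circ> half_turn) \<and> D \<subseteq> \<Union> (BU_level (level x))"
  \<comment> \<open>Exhibiting one admissible class guarantees that the chosen set is a Nielsen
    class too.\<close>
  have "?Q {y. level y = level x}"
  proof
    show "{y. level y = level x} \<in> Nielsen_classes f (f \<circ> half_turn)"
      using assms(1) by (auto simp: Nielsen_classes_eq)
    show "{y. level y = level x} \<subseteq> \<Union> (BU_level (level x))"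
    proof
      fix y assume y: "y \<in> {y. level y = level x}"
      then have "y \<in> coins" using assms(1) by (simp add: coins_iff)
      then have "{y, half_turn y} \<in> BU_level (level x)"
        using y by (auto simp: BU_level_def BUCoin_def)
      then show "y \<in> \<Union> (BU_level (level x))" by blast
    qed
  qed
  then have "?Q (SOME D. ?Q D)" by (rule someI)
  then obtain z where "z \<in> coins" "(SOME D. ?Q D) = {y. level y = level z}"
    by (auto simp: Nielsen_classes_eq)
  then have "(\<Sum>y\<in>(SOME D. ?Q D). index y) = 0"
    by (simp add: sum_index_Nielsen_class coins_iff)
  then show ?thesis
    using assms by (simp add: pseudo_index_def Let_def single_class_BU_level_iff)
qed

text \<open>Since \<open>a - m = m\<close>, half a period meets each orbit of the class exactly
  once. Over it \<open>m - G\<close> reverses its sign, so the indices there sum to 1 or -1, which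
  is odd.\<close>

lemma pseudo_index_single:
  assumes "2 * m = of_int a" "m \<in> \<int>" "x \<in> coins" "level x = m"
  shows "pseudo_index f half_turn (BU_level m) = 1"
proof -
  obtain \<alpha> where \<alpha>: "G \<alpha> \<noteq> m" using exists_off_level [OF assms(2)] .
  have half: "G (t + 1/2) = m \<longleftrightarrow> G t = m" for t
    using assms(1) by (auto simp: G_add_half)
  let ?Z = "{t \<in> {\<alpha>..\<alpha> + 1/2}. G t = m}"
  let ?P = "\<lambda>t. {circle_of_real t, half_turn (circle_of_real t)}"
  have "inj_on ?P ?Z"
  proof (rule inj_onI)
    fix s t assume st: "s \<in> ?Z" "t \<in> ?Z" "?P s = ?P t"
    then have ne: "s \<noteq> \<alpha>" "s \<noteq> \<alpha> + 1/2" "t \<noteq> \<alpha>" "t \<noteq> \<alpha> + 1/2" using \<alpha> half by auto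
    from st(3) consider "circle_of_real s = circle_of_real t" | "circle_of_real s = circle_of_real (t + 1/2)"
      unfolding circle_of_real_add_half by blast
    then show "s = t"
    proof cases
      case 1
      then show ?thesis using st by (intro circle_of_real_eq_imp_eq) auto
    next
      case 2
      \<comment> \<open>This would put \<open>s\<close> and \<open>t\<close> at opposite ends of the
        half period, but both ends lie off the level.\<close>
      then have "s = t + 1/2" by (rule circle_of_real_eq_imp_eq) (use st ne in auto)
      then show ?thesis using st ne by auto
    qed
  qed
  moreover have "BU_level m = ?P ` ?Z"
  proof
    show "?P ` ?Z \<subseteq> BU_level m"
      using assms(2) by (auto simp: BU_level_def BUCoin_def coins_iff level_of_real)
    show "BU_level m \<subseteq> ?P ` ?Z"
    proof
      fix P assume "P \<in> BU_level m"
      then obtain y where y: "y \<in> P" "level y = m" "P \<in> BUCoin f half_turn"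
        by (auto simp: BU_level_def)
      then have P: "P = {y, half_turn y}" by (blast dest: BUCoinE)
      obtain t where t: "t \<in> {\<alpha>..<\<alpha> + 1}" "y = circle_of_real t"
        by (rule circle_of_real_in_interval)
      show "P \<in> ?P ` ?Z"
      proof (cases "t \<le> \<alpha> + 1/2")
        case True
        then have "t \<in> ?Z" using t y by (auto simp: level_of_real)
        then show ?thesis unfolding P t(2) by blast
      next
        case False
        \<comment> \<open>A point in the second half of the period is replaced by its partner in the
          first half, which has the same level \<open>m\<close>.\<close>
        have "half_turn (circle_of_real (t - 1/2)) = y"
          by (simp add: t flip: circle_of_real_add_half)
        then have "P = ?P (t - 1/2)"
          unfolding P by (metis half_turn_involution insert_commute)
        moreover have "t - 1/2 \<in> ?Z"
          using t y False half [of "t - 1/2"] by (auto simp: level_of_real)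
        ultimately show ?thesis by blast
      qed
    qed
  qed
  ultimately have sum: "(\<Sum>P\<in>BU_level m. index (SOME x. x \<in> P)) = (\<Sum>t\<in>?Z. index (SOME x. x \<in> ?P t))"
    by (simp add: sum.reindex)
  \<comment> \<open>The representative picked by \<open>SOME\<close> may be either point of the
    orbit; this changes an index at most by sign and leaves the parity alone.\<close>
  have "even ((\<Sum>t\<in>?Z. index (SOME x. x \<in> ?P t)) - (\<Sum>t\<in>?Z. index (circle_of_real t)))"
    unfolding sum_subtractf [symmetric]
  proof (rule dvd_sum)
    fix t assume t: "t \<in> ?Z"
    then have "circle_of_real t \<in> coins"
      using assms(2) by (simp add: coins_iff level_of_real)
    note ind = index_half_turn [OF this]
    have "(SOME x. x \<in> ?P t) \<in> ?P t" by (rule someI [of _ "circle_of_real t"]) simp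
    then consider "(SOME x. x \<in> ?P t) = circle_of_real t" | "(SOME x. x \<in> ?P t) = half_turn (circle_of_real t)"
      by blast
    then show "even (index (SOME x. x \<in> ?P t) - index (circle_of_real t))"
      by cases (simp_all only: ind, simp_all)
  qed
  moreover have "odd (\<Sum>t\<in>?Z. index (circle_of_real t))"
  proof -
    have "m - G (\<alpha> + 1/2) = - (m - G \<alpha>)"
      using assms(1) by (simp add: G_add_half)
    then have "sgn (m - G (\<alpha> + 1/2)) = - sgn (m - G \<alpha>)"
      by (simp only: sgn_minus)
    then have "2 * real_of_int (\<Sum>t\<in>?Z. index (circle_of_real t)) = - 2 * sgn (m - G \<alpha>)"
      using sum_index_interval [OF assms(2), of \<alpha> "\<alpha> + 1/2"] \<alpha> half by simp
    then have "real_of_int (\<Sum>t\<in>?Z. index (circle_of_real t)) = 1 \<or>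
        real_of_int (\<Sum>t\<in>?Z. index (circle_of_real t)) = -1"
      using \<alpha> by (auto simp: sgn_if split: if_splits)
    then have "(\<Sum>t\<in>?Z. index (circle_of_real t)) = 1 \<or> (\<Sum>t\<in>?Z. index (circle_of_real t)) = -1"
      by linarith
    moreover have "v = 1 \<or> v = -1 \<Longrightarrow> odd v" for v :: int
      by auto
    ultimately show ?thesis by blast
  qed
  moreover have "even (u - v) \<Longrightarrow> odd v \<Longrightarrow> odd u" for u v :: int
    by presburger
  ultimately have "odd (\<Sum>P\<in>BU_level m. index (SOME x. x \<in> P))"
    unfolding sum by blast
  moreover have "single_class f half_turn (BU_level m)"
    using single_class_BU_level_iff [OF assms(3)] assms by simp
  ultimately show ?thesis
    by (simp add: pseudo_index_def Let_def type_A_half_turn [unfolded One_nat_def] odd_iff_mod_2_eq_one)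
qed

text \<open>Essential classes are exactly the single ones. These need an integer level equal to
  \<open>a/2\<close>, which rules out odd \<open>a\<close> and leaves the one class
  \<open>BU_level (a/2)\<close> for even \<open>a\<close>.\<close>

lemma NBU_finite_eq: "NBU_finite f half_turn = (if even a then 1 else 0)"
proof (cases "even a")
  case False
  have "2 * level x \<noteq> of_int a" if x: "x \<in> coins" for x
  proof
    assume eq: "2 * level x = of_int a"
    obtain n where "level x = of_int n"
      using x unfolding coins_iff by (rule Ints_cases)
    with eq have "2 * n = a" by (metis of_int_eq_iff of_int_mult of_int_numeral)
    with False show False by auto
  qed
  then have "{C \<in> BU_classes f half_turn. pseudo_index f half_turn C \<noteq> 0} = {}"
    using pseudo_index_double by (auto simp: BU_classes_eq)
  then show ?thesis using False by (simp only: NBU_finite_def card.empty if_False)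
next
  case True
  define m where "m = real_of_int (a div 2)"
  have m: "2 * m = of_int a" "m \<in> \<int>"
    using True by (auto simp: m_def)
  \<comment> \<open>The class must also be nonempty: \<open>G - m\<close> changes sign between 0 and
    1/2.\<close>
  have "\<exists>t. G t = m"
  proof (rule ccontr)
    assume "\<nexists>t. G t = m"
    then have "sgn (G 0 - m) = sgn (G (1/2) - m)"
      by (intro sgn_constant_if_no_zero) (auto intro!: continuous_intros continuous_G)
    moreover have "G (1/2) - m = - (G 0 - m)"
      using G_add_half [of 0] m(1) by simp
    ultimately have "G 0 = m"
      by (auto simp: sgn_if split: if_splits)
    with \<open>\<nexists>t. G t = m\<close> show False by blast
  qed
  then obtain t where "G t = m" ..
  then have x: "circle_of_real t \<in> coins" "level (circle_of_real t) = m"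
    using m by (auto simp: coins_iff level_of_real)
  have "{C \<in> BU_classes f half_turn. pseudo_index f half_turn C \<noteq> 0} = {BU_level m}"
  proof
    show "{C \<in> BU_classes f half_turn. pseudo_index f half_turn C \<noteq> 0} \<subseteq> {BU_level m}"
    proof
      fix C assume "C \<in> {C \<in> BU_classes f half_turn. pseudo_index f half_turn C \<noteq> 0}"
      then obtain y where y: "y \<in> coins" "C = BU_level (level y)" "pseudo_index f half_turn C \<noteq> 0"
        by (auto simp: BU_classes_eq)
      then have "2 * level y = of_int a"
        using pseudo_index_double by blast
      with m have "level y = m" by simp
      with y show "C \<in> {BU_level m}" by simp
    qed
    show "{BU_level m} \<subseteq> {C \<in> BU_classes f half_turn. pseudo_index f half_turn C \<noteq> 0}"
      using pseudo_index_single [OF m x] x by (auto simp: BU_classes_eq)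
  qed
  then show ?thesis using True by (simp add: NBU_finite_def)
qed

end

section \<open>Maps of every degree with the fewest coincidences, and the theorem\<close>

lemma degree_lift_witness:
  obtains g G where "degree_lift g G a" "finite (Coin g (g \<circ> half_turn))"
    "finite (BUCoin g half_turn)" "card (BUCoin g half_turn) = (if even a then 1 else 0)"
proof -
  \<comment> \<open>For even \<open>a\<close> the linear map would have every point as a
    coincidence. With amplitude 1/4 the level is \<open>a/2\<close> minus half a cosine, so it stays
    within 1/2 of the integer \<open>a/2\<close> and attains no other integer. For odd
    \<open>a\<close> the level is constantly \<open>a/2\<close>, not an integer.\<close>
  define c :: real where "c = (if even a then 1/4 else 0)"
  define W where "W = (\<lambda>t. of_int a * t + c * cos (2 * pi * t))"
  have W1: "W (t + of_int n) = W t + of_int a * of_int n" for t n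
  proof -
    have "cos (2 * pi * (t + of_int n)) = cos (2 * pi * t)"
      by (simp add: distrib_left cos_add cos_int_2pin sin_int_2pin)
    then show ?thesis by (simp add: W_def distrib_left)
  qed
  have cont: "continuous_on UNIV W" unfolding W_def by (intro continuous_intros)
  have "circle_of_real (W s) = circle_of_real (W t)" if "s - t \<in> \<int>" for s t
  proof -
    from that obtain n where "s - t = of_int n" by (rule Ints_cases)
    then have "s = t + of_int n" by simp
    then show ?thesis by (simp add: W1 circle_of_real_eq_iff)
  qed
  moreover have "continuous_on UNIV (\<lambda>t. circle_of_real (W t))"
    using cont by (rule continuous_on_compose2 [OF continuous_on_circle_of_real [of UNIV]]) auto
  ultimately obtain g where g: "\<And>t. g (circle_of_real t) = circle_of_real (W t)"
    using circle_function_of_periodic [of "\<lambda>t. circle_of_real (W t)"] by metis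
  have lift: "degree_lift g W a"
    unfolding degree_lift_def using g cont W1 [of _ 1] by auto
  interpret circle_map_lift g W a by unfold_locales (rule lift)
  have level: "level (circle_of_real t) = of_int a / 2 - 2 * c * cos (2 * pi * t)" for t
  proof -
    have "cos (2 * pi * (t + 1/2)) = - cos (2 * pi * t)"
      by (simp add: distrib_left)
    then show ?thesis
      unfolding level_of_real G_def by (simp add: W_def field_simps)
  qed
  show thesis
  proof (cases "even a")
    case False
    have "x \<notin> coins" for x
    proof
      assume x: "x \<in> coins"
      obtain t where t: "x = circle_of_real t" by (rule circle_of_real_cases)
      obtain n where "level x = of_int n"
        using x unfolding coins_iff by (rule Ints_cases)
      then have "of_int a / 2 = real_of_int n"
        using False by (simp add: t level c_def)
      then have "real_of_int a = of_int (2 * n)" by simp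
      then have "a = 2 * n" by (simp only: of_int_eq_iff)
      with False show False by simp
    qed
    then have "coins = {}" by blast
    then show thesis using False by (intro that [OF lift]) (auto simp: BUCoin_def)
  next
    case True
    have coins: "coins = {circle_of_real (1/4), circle_of_real (1/4 + 1/2)}"
    proof
      show "coins \<subseteq> {circle_of_real (1/4), circle_of_real (1/4 + 1/2)}"
      proof
        fix x assume x: "x \<in> coins"
        obtain t where t: "x = circle_of_real t" by (rule circle_of_real_cases)
        have "level x \<in> \<int>" using x by (simp add: coins_iff)
        moreover have "level x = of_int (a div 2) - 1/2 * cos (2 * pi * t)"
          using True by (auto simp: t level c_def)
        ultimately have "of_int (a div 2) - level x \<in> \<int>" "of_int (a div 2) - level x = 1/2 * cos (2 * pi * t)"
          by auto
        then obtain k where k: "1/2 * cos (2 * pi * t) = of_int k"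
          by (metis Ints_cases)
        have "\<bar>1/2 * cos (2 * pi * t)\<bar> < 1"
          using abs_cos_le_one [of "2 * pi * t"] by linarith
        with k have "k = 0" by linarith
        with k have "cos (2 * pi * t) = 0" by simp
        then obtain j where "2 * pi * t = of_int j * pi + pi / 2"
          by (auto simp: cos_zero_iff_int2)
        then have "pi * (2 * t) = pi * (of_int j + 1/2)" by (simp add: algebra_simps)
        then have j: "2 * t = of_int j + 1/2" by (simp only: mult_cancel_left) simp
        \<comment> \<open>Modulo 1 the zeros of the cosine are 1/4 and 3/4, told apart by the parity
          of \<open>j\<close>.\<close>
        show "x \<in> {circle_of_real (1/4), circle_of_real (1/4 + 1/2)}"
        proof (cases "even j")
          case True
          then obtain i where "j = 2 * i" by (rule evenE)
          with j have "t - 1/4 = of_int i" by simp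
          then show ?thesis by (simp add: t circle_of_real_eq_iff)
        next
          case False
          then obtain i where "j = 2 * i + 1" by (rule oddE)
          with j have "t - (1/4 + 1/2) = of_int i" by simp
          then have "x = circle_of_real (1/4 + 1/2)"
            unfolding t circle_of_real_eq_iff by simp
          then show ?thesis by blast
        qed
      qed
      have "cos (2 * pi * (1/4)) = 0" using cos_pi_half by simp
      then have "level (circle_of_real (1/4)) \<in> \<int>"
        using True by (auto simp: level)
      then have "circle_of_real (1/4) \<in> coins"
        by (simp only: coins_iff)
      then show "{circle_of_real (1/4), circle_of_real (1/4 + 1/2)} \<subseteq> coins"
        unfolding circle_of_real_add_half by (simp add: half_turn_coins_iff)
    qed
    have "BUCoin g half_turn = {{circle_of_real (1/4), circle_of_real (1/4 + 1/2)}}"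
      unfolding BUCoin_def coins circle_of_real_add_half
      by (simp add: half_turn_involution insert_commute)
    then show thesis
      using True coins by (intro that [OF lift]) auto
  qed
qed

text \<open>The description of \<open>NBU\<close> denotes a unique number: a homotopic map with
  finite coincidence set exists by \<open>degree_lift_witness\<close>, and every such map has degree
  \<open>a\<close>, so \<open>NBU_finite_eq\<close> gives all of them the same value.\<close>

lemma NBU_degree_lift:
  assumes "degree_lift f F a"
  shows "NBU f half_turn = (if even a then 1 else 0)"
  unfolding NBU_def
proof (rule the_equality)
  obtain g G where g: "degree_lift g G a" "finite (Coin g (g \<circ> half_turn))"
    by (rule degree_lift_witness)
  then interpret finite_coin_lift g G a by unfold_locales
  show "\<exists>g. homotopic_with_canon (\<lambda>_. True) UNIV UNIV f g \<and>
            finite (Coin g (g \<circ> half_turn)) \<and> NBU_finite g half_turn = (if even a then 1 else 0)"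
    using degree_lift_homotopic [OF assms g(1)] g(2) NBU_finite_eq by blast
next
  fix k
  assume "\<exists>g. homotopic_with_canon (\<lambda>_. True) UNIV UNIV f g \<and>
            finite (Coin g (g \<circ> half_turn)) \<and> NBU_finite g half_turn = k"
  then obtain g where g: "homotopic_with_canon (\<lambda>_. True) UNIV UNIV f g"
      "finite (Coin g (g \<circ> half_turn))" "NBU_finite g half_turn = k"
    by blast
  obtain G where "degree_lift g G a" using homotopic_degree_lift [OF g(1) assms] .
  with g(2) interpret finite_coin_lift g G a by unfold_locales
  show "k = (if even a then 1 else 0)" using NBU_finite_eq g(3) by simp
qed

theorem theorem3p1:
  shows "(\<forall>(f :: circle \<Rightarrow> circle) (a :: int).
            continuous_on UNIV f \<and> pi1_multiplication f a \<longrightarrow>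
            NBU f half_turn = (if even a then 1 else 0)) \<and>
         (\<forall>f :: circle \<Rightarrow> circle. continuous_on UNIV f \<longrightarrow>
            (\<exists>f'. realizes_NBU f' f half_turn))"
proof (intro conjI allI impI)
  fix f :: "circle \<Rightarrow> circle" and a :: int
  assume f: "continuous_on UNIV f \<and> pi1_multiplication f a"
  then obtain F b where F: "degree_lift f F b" using degree_lift_exists by blast
  with f have "a = b" using pi1_multiplication_degree_lift by blast
  with F show "NBU f half_turn = (if even a then 1 else 0)"
    using NBU_degree_lift by blast
next
  fix f :: "circle \<Rightarrow> circle"
  assume "continuous_on UNIV f"
  then obtain F a where F: "degree_lift f F a" using degree_lift_exists by blast
  \<comment> \<open>The witness of the same degree is homotopic to \<open>f\<close>, and its number
    of orbits equals the value of \<open>NBU\<close>.\<close>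
  obtain g G where g: "degree_lift g G a" "finite (BUCoin g half_turn)"
      "card (BUCoin g half_turn) = (if even a then 1 else 0)"
    by (rule degree_lift_witness)
  have "realizes_NBU g f half_turn"
    unfolding realizes_NBU_def NBU_degree_lift [OF F]
    using degree_lift_homotopic [OF F g(1)] g by blast
  then show "\<exists>f'. realizes_NBU f' f half_turn" by blast
qed

end
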